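(* Let $(K_n)_{n=1}^\infty$ be the optimal constants satisfying the multilinear Bohnenblust--Hille inequality for complex scalars, let $\gamma$ be the Euler--Mascheroni constant, and let $$C_{0}=\left(\frac{2e^{\frac12}-2e^{\frac12\gamma}}{\sqrt{\pi}}\right)\left(\frac{-4e^{\frac12}\ln 2+(1-\gamma)\left(e^{\frac12}+2e^{\frac12\gamma}\right)}{e^{\frac12\gamma+\frac12}(1-\gamma)}\right)+1.$$ Then for all $n\ge2$, $$K_{n}<\frac{\frac{4}{\sqrt{\pi}}-\frac{4}{e^{\frac12-\frac12\gamma}\sqrt{\pi}}}{1+\log_{2}\left(\frac{e^{\frac12-\frac12\gamma}}{2}\right)}\,(n-1)^{\log_{2}\left(e^{\frac12-\frac12\gamma}\right)}+C_{0}.$$ Numerically, for all $n\ge2$, $$K_n<1.41\,(n-1)^{0.304975}-0.04.$$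
   Context: For a positive integer $n$, $K_n$ denotes the optimal constant in the complex $n$-linear Bohnenblust--Hille inequality, i.e. the smallest $C\in[1,\infty)$ such that $$\left(\sum_{i_1,\ldots,i_n=1}^N |U(e_{i_1},\ldots,e_{i_n})|^{\frac{2n}{n+1}}\right)^{\frac{n+1}{2n}}\le C\,\sup_{z_1,\ldots,z_n\in\mathbb{D}^N}|U(z_1,\ldots,z_n)|$$ for all positive integers $N$ and all $n$-linear forms $U:\mathbb{C}^N\times\cdots\times\mathbb{C}^N\to\mathbb{C}$, where $(e_i)_{i=1}^N$ is the canonical basis of $\mathbb{C}^N$ and $\mathbb{D}^N$ is the open unit polydisc in $\mathbb{C}^N$. Such finite constants exist (Bohnenblust--Hille theorem). The Euler--Mascheroni constant is $\gamma=\lim_{m\to\infty}\left(-\log m+\sum_{k=1}^m \frac1k\right)\approx0.5772$. *)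

theory Defs
  imports "HOL-Analysis.Analysis" "Jordan_Normal_Form.Matrix"
begin

text \<open>
  The dimension N is quantified inside the definition of the optimal constant, so the space of
  complex N-vectors is the set \<^term>\<open>carrier_vec N\<close> of vectors of dimension N (with coordinates
  numbered from 0).  An n-tuple of vectors is an extensional function on \<^term>\<open>{..<n}\<close>.
\<close>

definition multilinear_form :: "nat \<Rightarrow> nat \<Rightarrow> ((nat \<Rightarrow> complex Matrix.vec) \<Rightarrow> complex) \<Rightarrow> bool" where
  "multilinear_form n N U \<longleftrightarrow>
     (\<forall>z \<in> {..<n} \<rightarrow>\<^sub>E carrier_vec N. \<forall>k<n.
        (\<forall>x \<in> carrier_vec N. \<forall>y \<in> carrier_vec N.
           U (z(k := x + y)) = U (z(k := x)) + U (z(k := y))) \<and>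
        (\<forall>a. \<forall>x \<in> carrier_vec N. U (z(k := a \<cdot>\<^sub>v x)) = a * U (z(k := x))))"

definition open_polydisc :: "nat \<Rightarrow> complex Matrix.vec set" where
  "open_polydisc N = {z \<in> carrier_vec N. \<forall>i<N. cmod (vec_index z i) < 1}"

text \<open>
  A multilinear form is bounded on the polydisc, so the real supremum below is a genuine one.
\<close>

definition bohnenblust_hille :: "nat \<Rightarrow> real \<Rightarrow> bool" where
  "bohnenblust_hille n C \<longleftrightarrow>
     (\<forall>N\<ge>1. \<forall>U. multilinear_form n N U \<longrightarrow>
        (\<Sum>i \<in> {..<n} \<rightarrow>\<^sub>E {..<N}.
            cmod (U (\<lambda>k\<in>{..<n}. unit_vec N (i k))) powr (2 * real n / (real n + 1)))
          powr ((real n + 1) / (2 * real n))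
        \<le> C * (SUP z \<in> {..<n} \<rightarrow>\<^sub>E open_polydisc N. cmod (U z)))"

definition BH_const :: "nat \<Rightarrow> real" where
  "BH_const n = (LEAST C. 1 \<le> C \<and> bohnenblust_hille n C)"

end

theory Submission
  imports Defs
begin

text \<open>
  Passing from \<open>n - 1\<close> to \<open>n\<close> costs little.  Fix one variable of an \<open>n\<close>-linear form at a vector of
  random unimodular numbers \<open>w\<^sub>x\<close>: what remains is an \<open>(n - 1)\<close>-linear form with the same bound, so the
  inequality for \<open>n - 1\<close>, with its exponent \<open>p = 2 (n - 1) / n\<close>, applies to it.  Averaging over \<open>w\<close>
  and using a Khinchine inequality \<open>(\<Sum>\<bar>a\<^sub>x\<bar>\<^sup>2) powr (p/2) \<le> exp (2 c / n) E \<bar>\<Sum>w\<^sub>x a\<^sub>x\<bar>\<^sup>p\<close> bounds the mixed norm of the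
  coefficients that is \<open>\<ell>\<^sub>2\<close> in the fixed variable and \<open>\<ell>\<^sub>p\<close> in the others.  The variable was arbitrary,
  and the \<open>n\<close> mixed norms obtained in this way control the \<open>\<ell>\<^sub>q\<close> norm, \<open>q = 2 n / (n + 1)\<close>
  (\<open>Blei_mixed_norm\<close>, a consequence of the Loomis--Whitney and Hoelder inequalities).  The outcome is
  \<open>K\<^sub>n \<le> exp (c / (n - 1)) K\<^sub>n\<^sub>-\<^sub>1\<close>, hence \<open>K\<^sub>n \<le> exp (c (1 + 1/2 + \<dots> + 1/(n - 1)))\<close>, which is at most
  \<open>exp c (n - 1)\<^sup>c\<close>.

  The theorem asks for growth of order \<open>(n - 1)\<close> to the power \<open>(1 - \<gamma>) / (2 ln 2) = 0.30497\<dots>\<close>, whereas the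
  optimal Khinchine constants would lead to the power \<open>(1 - \<gamma>) / 2 = 0.2114\<dots>\<close>.  This leaves room for the value
  \<open>c = 15/56 = 0.2678\<dots>\<close>, which has an elementary proof.  By Jensen's inequality the constant for
  exponents \<open>p < 2\<close> is governed by the entropy \<open>E X ln X\<close> of \<open>X = \<bar>\<Sum>w\<^sub>x a\<^sub>x\<bar>\<^sup>2\<close>, normalized by \<open>E X = 1\<close>.  The
  logarithm lies below the cubic polynomial of \<open>ln_le_cubic\<close>, so the entropy is bounded in terms of the
  first four moments of \<open>X\<close>, and these are explicit.  They involve only finitely many Fourier modes of
  the \<open>w\<^sub>x\<close>, and fifth roots of unity already have the moments of the uniform distribution on the circle
  up to that order; so every average is a finite sum.
\<close>

section \<open>Hoelder, Loomis--Whitney and Blei inequalities\<close>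

lemma sum_PiE_insert:
  assumes "j \<notin> A"
  shows "(\<Sum>i\<in>PiE (insert j A) I. f i) = (\<Sum>i\<in>PiE A I. \<Sum>x\<in>I j. f (i(j := x)))"
proof -
  have "(\<Sum>i\<in>PiE (insert j A) I. f i) = (\<Sum>(x, i)\<in>I j \<times> PiE A I. f (i(j := x)))"
    unfolding PiE_insert_eq by (subst sum.reindex[OF inj_combinator[OF assms]]) (simp add: case_prod_unfold)
  also have "\<dots> = (\<Sum>x\<in>I j. \<Sum>i\<in>PiE A I. f (i(j := x)))"
    by (simp add: sum.cartesian_product)
  also have "\<dots> = (\<Sum>i\<in>PiE A I. \<Sum>x\<in>I j. f (i(j := x)))"
    by (rule sum.swap)
  finally show ?thesis .
qed

lemma sum_PiE_remove:
  assumes "j \<in> A"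
  shows "(\<Sum>i\<in>PiE A I. f i) = (\<Sum>i\<in>PiE (A - {j}) I. \<Sum>x\<in>I j. f (i(j := x)))"
  using sum_PiE_insert[of j "A - {j}"] assms by (simp add: insert_absorb)

text \<open>
  After division by the arithmetic mean this is the product of the inequalities
  \<open>y powr \<theta> \<le> exp (\<theta> (y - 1))\<close>.
\<close>

lemma weighted_geometric_mean_le_arithmetic_mean:
  fixes \<theta> x :: "'a \<Rightarrow> real"
  assumes fin: "finite J" and \<theta>: "\<And>j. j \<in> J \<Longrightarrow> \<theta> j > 0" "sum \<theta> J = 1"
    and x: "\<And>j. j \<in> J \<Longrightarrow> x j \<ge> 0"
  shows "(\<Prod>j\<in>J. x j powr \<theta> j) \<le> (\<Sum>j\<in>J. \<theta> j * x j)"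
proof (cases "\<exists>j\<in>J. x j = 0")
  case True
  then have "(\<Prod>j\<in>J. x j powr \<theta> j) = 0" using fin by (intro prod_zero) auto
  then show ?thesis using \<theta> x by (simp add: sum_nonneg less_imp_le)
next
  case False
  define m where "m = (\<Sum>j\<in>J. \<theta> j * x j)"
  have pos: "x j > 0" if "j \<in> J" for j using False x that by (metis order_le_less)
  have "J \<noteq> {}" using \<theta>(2) by auto
  then have m: "m > 0" unfolding m_def using fin \<theta> pos by (intro sum_pos) auto
  have "(\<Prod>j\<in>J. (x j / m) powr \<theta> j) \<le> (\<Prod>j\<in>J. exp (\<theta> j * (x j / m - 1)))"
  proof (intro prod_mono conjI)
    fix j assume j: "j \<in> J"
    have "ln (x j / m) \<le> x j / m - 1" using pos[OF j] m by (intro ln_le_minus_one) simp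
    then show "(x j / m) powr \<theta> j \<le> exp (\<theta> j * (x j / m - 1))"
      using pos[OF j] m \<theta>(1)[OF j] unfolding powr_def by simp
  qed simp
  also have "\<dots> = exp (\<Sum>j\<in>J. \<theta> j * (x j / m - 1))" using fin by (simp add: exp_sum)
  also have "(\<Sum>j\<in>J. \<theta> j * (x j / m - 1)) = 0"
  proof -
    have "(\<Sum>j\<in>J. \<theta> j * (x j / m - 1)) = m / m - sum \<theta> J"
      unfolding m_def by (simp only: right_diff_distrib sum_subtractf times_divide_eq_right
          sum_divide_distrib mult_1_right)
    then show ?thesis using m \<theta>(2) by simp
  qed
  finally have "(\<Prod>j\<in>J. (x j / m) powr \<theta> j) \<le> 1" by simp
  moreover have "(\<Prod>j\<in>J. (x j / m) powr \<theta> j) = (\<Prod>j\<in>J. x j powr \<theta> j) / m"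
  proof -
    have "(\<Prod>j\<in>J. m powr \<theta> j) = m powr sum \<theta> J" using m by (simp add: powr_sum)
    then show ?thesis using x m \<theta>(2) by (simp add: powr_divide prod_dividef)
  qed
  ultimately show ?thesis using m unfolding m_def[symmetric] by (simp add: field_simps)
qed

lemma weighted_Holder_sum:
  fixes \<theta> :: "'a \<Rightarrow> real" and T :: "'a \<Rightarrow> 'b \<Rightarrow> real"
  assumes fin: "finite J" "finite X" and \<theta>: "\<And>j. j \<in> J \<Longrightarrow> \<theta> j > 0" "sum \<theta> J = 1"
    and T: "\<And>j x. j \<in> J \<Longrightarrow> x \<in> X \<Longrightarrow> T j x \<ge> 0"
  shows "(\<Sum>x\<in>X. \<Prod>j\<in>J. T j x powr \<theta> j) \<le> (\<Prod>j\<in>J. (\<Sum>x\<in>X. T j x) powr \<theta> j)"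
proof (cases "\<exists>j\<in>J. (\<Sum>x\<in>X. T j x) = 0")
  case True
  then obtain k where k: "k \<in> J" "(\<Sum>x\<in>X. T k x) = 0" by auto
  then have "T k x = 0" if "x \<in> X" for x
    using sum_nonneg_eq_0_iff[of X "T k"] fin T that by auto
  then have "(\<Prod>j\<in>J. T j x powr \<theta> j) = 0" if "x \<in> X" for x
    using fin k that by (intro prod_zero) auto
  then show ?thesis by (simp add: prod_nonneg)
next
  case False
  define s where "s j = (\<Sum>x\<in>X. T j x)" for j
  have s: "s j > 0" if "j \<in> J" for j
    using False T that unfolding s_def by (metis order_le_less sum_nonneg)
  define P where "P = (\<Prod>j\<in>J. s j powr \<theta> j)"
  have P: "P > 0" unfolding P_def using s by (intro prod_pos) (simp add: less_imp_neq[symmetric])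
  have "(\<Sum>x\<in>X. \<Prod>j\<in>J. T j x powr \<theta> j) = P * (\<Sum>x\<in>X. \<Prod>j\<in>J. (T j x / s j) powr \<theta> j)"
    unfolding sum_distrib_left
  proof (rule sum.cong[OF refl])
    fix x assume x: "x \<in> X"
    have "(\<Prod>j\<in>J. T j x powr \<theta> j) = (\<Prod>j\<in>J. s j powr \<theta> j * (T j x / s j) powr \<theta> j)"
    proof (rule prod.cong[OF refl])
      fix j assume j: "j \<in> J"
      show "T j x powr \<theta> j = s j powr \<theta> j * (T j x / s j) powr \<theta> j"
        using s[OF j] T[OF j x] by (simp add: powr_divide)
    qed
    then show "(\<Prod>j\<in>J. T j x powr \<theta> j) = P * (\<Prod>j\<in>J. (T j x / s j) powr \<theta> j)"
      unfolding P_def by (simp add: prod.distrib)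
  qed
  also have "(\<Sum>x\<in>X. \<Prod>j\<in>J. (T j x / s j) powr \<theta> j) \<le> (\<Sum>x\<in>X. \<Sum>j\<in>J. \<theta> j * (T j x / s j))"
    using fin \<theta> T s
    by (intro sum_mono weighted_geometric_mean_le_arithmetic_mean) (auto simp: less_imp_le)
  also have "\<dots> = (\<Sum>j\<in>J. \<Sum>x\<in>X. \<theta> j * (T j x / s j))" by (rule sum.swap)
  also have "\<dots> = (\<Sum>j\<in>J. \<theta> j)"
  proof (rule sum.cong[OF refl])
    fix j assume "j \<in> J"
    then show "(\<Sum>x\<in>X. \<theta> j * (T j x / s j)) = \<theta> j"
      using s[of j] by (simp add: s_def sum_distrib_left[symmetric] sum_divide_distrib[symmetric])
  qed
  finally show ?thesis using P \<theta>(2) unfolding P_def s_def by simp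
qed

lemma Holder_sum:
  fixes f g :: "'b \<Rightarrow> real"
  assumes "finite X" "0 < \<theta>" "\<theta> < 1"
    and "\<And>x. x \<in> X \<Longrightarrow> f x \<ge> 0" "\<And>x. x \<in> X \<Longrightarrow> g x \<ge> 0"
  shows "(\<Sum>x\<in>X. f x powr \<theta> * g x powr (1 - \<theta>))
         \<le> (\<Sum>x\<in>X. f x) powr \<theta> * (\<Sum>x\<in>X. g x) powr (1 - \<theta>)"
  using weighted_Holder_sum[of "UNIV :: bool set" X "\<lambda>b. if b then \<theta> else 1 - \<theta>" "\<lambda>b. if b then f else g"]
    assms by (simp add: UNIV_bool mult.commute split: if_splits)

lemma prod_powr_nonneg:
  fixes f :: "'a \<Rightarrow> real"
  assumes "\<And>j. j \<in> J \<Longrightarrow> f j \<ge> 0"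
  shows "(\<Prod>j\<in>J. f j) powr a = (\<Prod>j\<in>J. f j powr a)"
  using assms by (induction J rule: infinite_finite_induct) (auto simp: powr_mult prod_nonneg)

text \<open>
  The functional form of the Loomis--Whitney inequality, with the powers placed so that
  the right-hand side contains plain sums.  In the induction one coordinate \<open>a\<close> is frozen: the factor
  \<open>G a\<close> does not depend on it and is split off by Hoelder, the others are handled by the
  induction hypothesis, and Hoelder over the values of the frozen coordinate puts the slices together.
\<close>

lemma Loomis_Whitney:
  fixes G :: "nat \<Rightarrow> (nat \<Rightarrow> nat) \<Rightarrow> real"
  assumes "finite A" "card A = Suc m" "m \<ge> 1" and I: "\<And>j. finite (I j)"
    and "\<And>j i. j \<in> A \<Longrightarrow> i \<in> PiE (A - {j}) I \<Longrightarrow> G j i \<ge> 0"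
  shows "(\<Sum>i\<in>PiE A I. \<Prod>j\<in>A. G j (restrict i (A - {j})) powr (1 / real m))
         \<le> (\<Prod>j\<in>A. (\<Sum>i\<in>PiE (A - {j}) I. G j i) powr (1 / real m))"
  using \<open>m \<ge> 1\<close> assms(1,2,5)
proof (induction m arbitrary: A G rule: nat_induct_at_least)
  case base
  from base(2) obtain a b where ab: "A = {a, b}" "a \<noteq> b"
    by (metis One_nat_def Suc_1 card_2_iff)
  define g where "g x = G a ((\<lambda>_. undefined)(b := x))" for x
  define h where "h x = G b ((\<lambda>_. undefined)(a := x))" for x
  have A: "A - {a} = {b}" "A - {b} = {a}" using ab by auto
  have g: "g x \<ge> 0" if "x \<in> I b" for x
    unfolding g_def using ab that by (intro base(3)) (auto simp: A PiE_def extensional_def)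
  have h: "h x \<ge> 0" if "x \<in> I a" for x
    unfolding h_def using ab that by (intro base(3)) (auto simp: A PiE_def extensional_def)
  have sing: "(\<Sum>i\<in>PiE {j} I. f i) = (\<Sum>x\<in>I j. f ((\<lambda>_. undefined)(j := x)))"
    for j and f :: "(nat \<Rightarrow> nat) \<Rightarrow> real"
    using sum_PiE_insert[of j "{}" f I] by (simp add: fun_upd_def)
  have r: "restrict (i(a := x)) {b} = (\<lambda>_. undefined)(b := i b)"
    "restrict (i(a := x)) {a} = (\<lambda>_. undefined)(a := x)" for i :: "nat \<Rightarrow> nat" and x
    using ab by (auto simp: restrict_def fun_eq_iff)
  have "(\<Sum>i\<in>PiE A I. \<Prod>j\<in>A. G j (restrict i (A - {j})) powr (1 / real 1))
    = (\<Sum>y\<in>I b. \<Sum>x\<in>I a. g y powr 1 * h x powr 1)"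
    unfolding ab(1) using ab(2)
    by (simp add: sum_PiE_insert sing A[unfolded ab(1)] r g_def h_def del: powr_one_eq_one
        cong: if_cong)
  also have "\<dots> = (\<Sum>y\<in>I b. \<Sum>x\<in>I a. g y * h x)"
    using g h by (intro sum.cong refl) auto
  also have "\<dots> = (\<Sum>y\<in>I b. g y) * (\<Sum>x\<in>I a. h x)" by (simp add: sum_product)
  also have "\<dots> = (\<Prod>j\<in>A. (\<Sum>i\<in>PiE (A - {j}) I. G j i) powr (1 / real 1))"
    using ab g h by (simp add: sing A[unfolded ab(1)] g_def h_def sum_nonneg)
  finally show ?case by (rule order_eq_refl)
next
  case (Suc m)
  obtain a where a: "a \<in> A" using Suc.prems(2) by (cases "A = {}") auto
  define A' where "A' = A - {a}"
  have A': "A = insert a A'" "a \<notin> A'" "finite A'" "card A' = Suc m"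
    using a Suc.prems by (auto simp: A'_def)
  define t where "t = 1 / real (Suc m)"
  have t: "0 < t" "t < 1" "1 - t = real m * t" "(1 / real m) * (real m * t) = t"
    using Suc.hyps by (auto simp: t_def field_simps)
  have tsum: "(\<Sum>j\<in>A'. t) = 1" using A' by (simp add: t_def)
  define G' where "G' x j i = G j (i(a := x))" for x j i
  have G'0: "G' x j i \<ge> 0" if "x \<in> I a" "j \<in> A'" "i \<in> PiE (A' - {j}) I" for x j i
    unfolding G'_def using that A'
    by (intro Suc.prems(3)) (auto simp: PiE_iff extensional_def)
  have Ga0: "G a i \<ge> 0" if "i \<in> PiE A' I" for i
    using that a Suc.prems(3) by (simp add: A'_def)
  have finP: "finite (PiE B I)" if "B \<subseteq> A" for B
    using that Suc.prems(1) I by (intro finite_PiE) (auto intro: finite_subset)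
  define Pf where "Pf x i = (\<Prod>j\<in>A'. G' x j (restrict i (A' - {j})) powr (1 / real m))" for x i
  define S where "S x j = (\<Sum>i\<in>PiE (A' - {j}) I. G' x j i)" for x j
  have S0: "S x j \<ge> 0" if "x \<in> I a" "j \<in> A'" for x j
    unfolding S_def using G'0 that by (intro sum_nonneg) auto
  have split: "(\<Prod>j\<in>A. G j (restrict (i(a := x)) (A - {j})) powr t)
      = G a i powr t * Pf x i powr (1 - t)" if "i \<in> PiE A' I" "x \<in> I a" for i x
  proof -
    have "restrict (i(a := x)) (A - {a}) = i"
      using that A' by (auto simp: fun_eq_iff restrict_def PiE_iff extensional_def)
    moreover have "restrict (i(a := x)) (A - {j}) = (restrict i (A' - {j}))(a := x)"
      if "j \<in> A'" for j using that A' by (auto simp: fun_eq_iff restrict_def)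
    moreover have "Pf x i powr (1 - t) = (\<Prod>j\<in>A'. G' x j (restrict i (A' - {j})) powr t)"
      unfolding Pf_def using Suc.hyps by (subst prod_powr_nonneg) (simp_all add: powr_powr t(3))
    ultimately show ?thesis unfolding A'(1) using A' by (simp add: G'_def)
  qed
  have "(\<Sum>i\<in>PiE A I. \<Prod>j\<in>A. G j (restrict i (A - {j})) powr t)
      = (\<Sum>x\<in>I a. \<Sum>i\<in>PiE A' I. G a i powr t * Pf x i powr (1 - t))"
    unfolding sum_PiE_remove[OF a] A'_def[symmetric]
    by (subst sum.swap, intro sum.cong refl) (use split in auto)
  also have "\<dots> \<le> (\<Sum>x\<in>I a. (\<Sum>i\<in>PiE A' I. G a i) powr t * (\<Prod>j\<in>A'. S x j powr t))"
  proof (rule sum_mono)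
    fix x assume x: "x \<in> I a"
    have "(\<Sum>i\<in>PiE A' I. G a i powr t * Pf x i powr (1 - t))
       \<le> (\<Sum>i\<in>PiE A' I. G a i) powr t * (\<Sum>i\<in>PiE A' I. Pf x i) powr (1 - t)"
      using t Ga0 finP[of A'] A' by (intro Holder_sum) (auto simp: Pf_def intro: prod_nonneg)
    also have "(\<Sum>i\<in>PiE A' I. Pf x i) powr (1 - t) \<le> (\<Prod>j\<in>A'. S x j powr (1 / real m)) powr (1 - t)"
    proof (rule powr_mono2)
      show "(\<Sum>i\<in>PiE A' I. Pf x i) \<le> (\<Prod>j\<in>A'. S x j powr (1 / real m))"
        unfolding Pf_def S_def by (rule Suc.IH) (use A' G'0[OF x] in auto)
    qed (use t in \<open>auto simp: Pf_def intro!: sum_nonneg prod_nonneg\<close>)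
    also have "(\<Prod>j\<in>A'. S x j powr (1 / real m)) powr (1 - t) = (\<Prod>j\<in>A'. S x j powr t)"
      using Suc.hyps by (subst prod_powr_nonneg) (simp_all add: powr_powr t(3))
    finally show "(\<Sum>i\<in>PiE A' I. G a i powr t * Pf x i powr (1 - t))
       \<le> (\<Sum>i\<in>PiE A' I. G a i) powr t * (\<Prod>j\<in>A'. S x j powr t)"
      by (simp add: mult_left_mono)
  qed
  also have "\<dots> = (\<Sum>i\<in>PiE A' I. G a i) powr t * (\<Sum>x\<in>I a. \<Prod>j\<in>A'. S x j powr t)"
    by (simp add: sum_distrib_left)
  also have "(\<Sum>x\<in>I a. \<Prod>j\<in>A'. S x j powr t) \<le> (\<Prod>j\<in>A'. (\<Sum>x\<in>I a. S x j) powr t)"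
    using weighted_Holder_sum[of A' "I a" "\<lambda>_. t" "\<lambda>j x. S x j"] A' I t tsum S0 by simp
  also have "(\<Prod>j\<in>A'. (\<Sum>x\<in>I a. S x j) powr t) = (\<Prod>j\<in>A'. (\<Sum>i\<in>PiE (A - {j}) I. G j i) powr t)"
  proof (intro prod.cong refl arg_cong[where f = "\<lambda>s. s powr t"])
    fix j assume j: "j \<in> A'"
    have "A - {j} = insert a (A' - {j})" "a \<notin> A' - {j}" using j A' by auto
    then have "(\<Sum>i\<in>PiE (A - {j}) I. G j i) = (\<Sum>i\<in>PiE (A' - {j}) I. \<Sum>x\<in>I a. G' x j i)"
      unfolding G'_def by (simp only: sum_PiE_insert not_False_eq_True)
    also have "\<dots> = (\<Sum>x\<in>I a. S x j)"
      unfolding S_def by (rule sum.swap)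
    finally show "(\<Sum>x\<in>I a. S x j) = (\<Sum>i\<in>PiE (A - {j}) I. G j i)" by (rule sym)
  qed
  finally show ?case
    unfolding t_def[symmetric] using A' by (simp add: mult_left_mono A'_def[symmetric])
qed

text \<open>
  With \<open>n = m + 1\<close> variables and \<open>u\<close> the squared modulus of a coefficient array, this bounds the
  \<open>\<ell>\<^sub>q\<close> norm, \<open>q = 2 n / (n + 1)\<close>, by the geometric mean of the mixed norms that are \<open>\<ell>\<^sub>2\<close> in the
  variable \<open>j\<close> and \<open>\<ell>\<^sub>p\<close>, \<open>p = 2 (n - 1) / n\<close>, in the others.  If \<open>B\<^sub>j\<close> denotes the sum of \<open>u\<close> over the
  variable \<open>j\<close>, then the power of \<open>u\<close> to be summed is the geometric mean, with equal weights
  \<open>1 / (n + 1)\<close>, of the \<open>n\<close> functions \<open>u / B\<^sub>j powr (1 / n)\<close> and of \<open>\<Prod>\<^sub>j B\<^sub>j powr (1 / n)\<close>.  The former sum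
  up to powers of the mixed norms, and the latter is of Loomis--Whitney type.
\<close>

lemma Blei_mixed_norm:
  fixes u :: "(nat \<Rightarrow> nat) \<Rightarrow> real"
  assumes fin: "finite A" and card: "card A = Suc m" "m \<ge> 1" and I: "\<And>j. finite (I j)"
    and u: "\<And>i. i \<in> PiE A I \<Longrightarrow> u i \<ge> 0"
  shows "(\<Sum>i\<in>PiE A I. u i powr (real (Suc m) / real (m + 2)))
    \<le> (\<Prod>j\<in>A. (\<Sum>i\<in>PiE (A - {j}) I. (\<Sum>x\<in>I j. u (i(j := x))) powr (real m / real (Suc m)))
          powr (real (Suc m) / (real m * real (m + 2))))"
proof -
  define n where "n = real (Suc m)"
  define t where "t = 1 / (n + 1)"
  define B where "B j i = (\<Sum>x\<in>I j. u (i(j := x)))" for j i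
  define S where "S j = (\<Sum>i\<in>PiE (A - {j}) I. B j i powr (real m / n))" for j
  have n: "n > 1" "real (m + 2) = n + 1" "real m = n - 1" using card(2) by (auto simp: n_def)
  have t: "t > 0" by (simp add: t_def n_def)
  have upd: "i(j := x) \<in> PiE A I" if "j \<in> A" "i \<in> PiE (A - {j}) I" "x \<in> I j" for i j x
    using that by (auto simp: PiE_iff extensional_def)
  have B0: "B j i \<ge> 0" if "j \<in> A" "i \<in> PiE (A - {j}) I" for i j
    unfolding B_def using upd that u by (intro sum_nonneg) auto
  have S0: "S j \<ge> 0" for j unfolding S_def by (intro sum_nonneg) auto
  have finP: "finite (PiE A I)" using fin I by (intro finite_PiE) auto
  define r where "r j i = restrict i (A - {j})" for j and i :: "nat \<Rightarrow> nat"
  have r: "r j i \<in> PiE (A - {j}) I" "i j \<in> I j" "(r j i)(j := i j) = i"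
    if "j \<in> A" "i \<in> PiE A I" for j i
    using that by (auto simp: r_def PiE_iff extensional_def fun_eq_iff restrict_def)
  have r_upd: "r j (i(j := x)) = i" if "j \<in> A" "i \<in> PiE (A - {j}) I" for i j x
    using that by (auto simp: r_def PiE_iff extensional_def fun_eq_iff restrict_def)
  have uB: "u i \<le> B j (r j i)" if "j \<in> A" "i \<in> PiE A I" for i j
  proof -
    have "u ((r j i)(j := i j)) \<le> B j (r j i)"
      unfolding B_def using r[OF that] that u upd
      by (intro member_le_sum[of _ _ "\<lambda>x. u ((r j i)(j := x))"]) (auto simp: I)
    then show ?thesis using r[OF that] by simp
  qed
  define T where "T k i = (case k of Some j \<Rightarrow> u i * B j (r j i) powr (- 1 / n)
      | None \<Rightarrow> \<Prod>j\<in>A. B j (r j i) powr (1 / n))" for k i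
  \<comment> \<open>\<open>Some j\<close> stands for the function attached to the variable \<open>j\<close>, \<open>None\<close> for the Loomis--Whitney product\<close>
  define J where "J = insert None (Some ` A)"
  have prodJ: "(\<Prod>k\<in>J. f k) = f None * (\<Prod>j\<in>A. f (Some j))" for f :: "nat option \<Rightarrow> real"
    unfolding J_def using fin by (subst prod.insert) (auto simp: prod.reindex)
  have sumJ: "(\<Sum>k\<in>J. f k) = f None + (\<Sum>j\<in>A. f (Some j))" for f :: "nat option \<Rightarrow> real"
    unfolding J_def using fin by (subst sum.insert) (auto simp: sum.reindex)
  have cA: "real (card A) = n" using card by (simp add: n_def)
  have "(\<Sum>i\<in>PiE A I. u i powr (n / (n + 1))) = (\<Sum>i\<in>PiE A I. \<Prod>k\<in>J. T k i powr t)"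
  proof (rule sum.cong[OF refl])
    fix i assume i: "i \<in> PiE A I"
    show "u i powr (n / (n + 1)) = (\<Prod>k\<in>J. T k i powr t)"
    proof (cases "u i = 0")
      case True
      then have "(\<Prod>j\<in>A. T (Some j) i powr t) = 0"
        using card fin by (simp add: T_def card_gt_0_iff)
      then show ?thesis using True by (simp add: prodJ)
    next
      case False
      then have ui: "u i > 0" using u[OF i] by simp
      then have Bp: "B j (r j i) > 0" if "j \<in> A" for j using uB[OF that i] by simp
      have "(\<Prod>k\<in>J. T k i powr t)
          = (\<Prod>j\<in>A. B j (r j i) powr (1 / n)) powr t * (\<Prod>j\<in>A. (u i * B j (r j i) powr (- 1 / n)) powr t)"
        by (simp add: prodJ T_def)
      also have "(\<Prod>j\<in>A. B j (r j i) powr (1 / n)) powr t = (\<Prod>j\<in>A. B j (r j i) powr (t / n))"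
        by (subst prod_powr_nonneg) (simp_all add: powr_powr)
      also have "\<dots> * (\<Prod>j\<in>A. (u i * B j (r j i) powr (- 1 / n)) powr t) = (\<Prod>j\<in>A. u i powr t)"
        unfolding prod.distrib[symmetric]
      proof (rule prod.cong[OF refl])
        fix j assume "j \<in> A"
        then have b: "B j (r j i) > 0" by (rule Bp)
        have "(u i * B j (r j i) powr (- 1 / n)) powr t = u i powr t * B j (r j i) powr (- (t / n))"
          using b ui by (simp add: powr_mult powr_powr)
        then show "B j (r j i) powr (t / n) * (u i * B j (r j i) powr (- 1 / n)) powr t = u i powr t"
          using b by (simp add: powr_minus field_simps)
      qed
      also have "\<dots> = u i powr (n / (n + 1))"
        using ui by (simp add: powr_power t_def cA)
      finally show ?thesis by simp
    qed
  qed
  also have "\<dots> \<le> (\<Prod>k\<in>J. (\<Sum>i\<in>PiE A I. T k i) powr t)"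
  proof (rule weighted_Holder_sum)
    show "finite J" using fin by (simp add: J_def)
    show "(\<Sum>k\<in>J. t) = 1" using n unfolding sumJ by (simp add: cA t_def field_simps)
    show "T k i \<ge> 0" if "k \<in> J" "i \<in> PiE A I" for k i
      using that u by (auto simp: J_def T_def split: option.splits intro: prod_nonneg)
  qed (use finP t in auto)
  also have "\<dots> = (\<Sum>i\<in>PiE A I. T None i) powr t * (\<Prod>j\<in>A. (\<Sum>i\<in>PiE A I. T (Some j) i) powr t)"
    by (rule prodJ)
  also have "(\<Prod>j\<in>A. (\<Sum>i\<in>PiE A I. T (Some j) i) powr t) = (\<Prod>j\<in>A. S j powr t)"
  proof (intro prod.cong refl arg_cong[where f = "\<lambda>s. s powr t"])
    fix j assume j: "j \<in> A"
    have "(\<Sum>i\<in>PiE A I. T (Some j) i)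
        = (\<Sum>i\<in>PiE (A - {j}) I. \<Sum>x\<in>I j. u (i(j := x)) * B j i powr (- 1 / n))"
      unfolding sum_PiE_remove[OF j] by (intro sum.cong refl) (simp add: T_def r_upd[OF j])
    also have "\<dots> = (\<Sum>i\<in>PiE (A - {j}) I. B j i powr (real m / n))"
    proof (rule sum.cong[OF refl])
      fix i assume i: "i \<in> PiE (A - {j}) I"
      have "(\<Sum>x\<in>I j. u (i(j := x)) * B j i powr (- 1 / n)) = B j i * B j i powr (- 1 / n)"
        by (simp add: B_def sum_distrib_right)
      also have "\<dots> = B j i powr (1 + - 1 / n)"
        using B0[OF j i] by (simp only: powr_mult_base)
      also have "1 + - 1 / n = real m / n" using n by (simp add: field_simps)
      finally show "(\<Sum>x\<in>I j. u (i(j := x)) * B j i powr (- 1 / n)) = B j i powr (real m / n)" .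
    qed
    finally show "(\<Sum>i\<in>PiE A I. T (Some j) i) = S j" by (simp add: S_def)
  qed
  also have "(\<Sum>i\<in>PiE A I. T None i) \<le> (\<Prod>j\<in>A. S j powr (1 / real m))"
  proof -
    have "T None i = (\<Prod>j\<in>A. (B j (restrict i (A - {j})) powr (real m / n)) powr (1 / real m))" for i
      using card by (simp add: T_def r_def powr_powr)
    then show ?thesis
      unfolding S_def using Loomis_Whitney[of A m I "\<lambda>j i. B j i powr (real m / n)"] assms by simp
  qed
  then have "(\<Sum>i\<in>PiE A I. T None i) powr t \<le> (\<Prod>j\<in>A. S j powr (1 / real m)) powr t"
    using t by (intro powr_mono2 sum_nonneg) (auto simp: T_def intro: prod_nonneg)
  also have "\<dots> = (\<Prod>j\<in>A. S j powr (t / real m))"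
    by (subst prod_powr_nonneg) (simp_all add: powr_powr)
  finally have "(\<Sum>i\<in>PiE A I. u i powr (n / (n + 1)))
      \<le> (\<Prod>j\<in>A. S j powr (t / real m)) * (\<Prod>j\<in>A. S j powr t)"
    by (simp add: mult_right_mono prod_nonneg)
  also have "\<dots> = (\<Prod>j\<in>A. S j powr (n / (real m * (n + 1))))"
  proof -
    have "t / real m + t = n / (real m * (n + 1))"
      unfolding t_def n(3) using n(1) by (simp add: divide_simps)
    then show ?thesis by (simp add: prod.distrib[symmetric] powr_add[symmetric])
  qed
  finally show ?thesis unfolding S_def B_def n_def by (simp add: add.commute)
qed

section \<open>A Khinchine inequality for fifth roots of unity\<close>

lemma power4_eq: "x ^ 4 = x * x * x * (x :: 'a :: monoid_mult)"
  by (simp add: eval_nat_numeral mult.assoc)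

definition fifth_roots :: "complex set" where
  "fifth_roots = {z. z ^ 5 = 1}"

lemma card_fifth_roots: "card fifth_roots = 5"
  using card_roots_unity_eq[of 5] by (simp add: fifth_roots_def)

lemma cmod_fifth_root: "z \<in> fifth_roots \<Longrightarrow> cmod z = 1"
  unfolding fifth_roots_def
  by (metis (mono_tags) mem_Collect_eq norm_one norm_power power_eq_1_iff zero_less_numeral norm_ge_zero
      pos2 zero_neq_numeral)

text \<open>
  This is where the order of the roots enters: the fourth moments below expand into powers of a
  root with exponents between -4 and 4, all of which have mean zero except the constant one.
\<close>

lemma sum_power_fifth_roots:
  assumes "j \<in> {1, 2, 3, 4}"
  shows "(\<Sum>z\<in>fifth_roots. z ^ j) = 0"
proof -
  have "\<not> fifth_roots \<subseteq> {1}"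
    using card_mono[of "{1 :: complex}" fifth_roots] by (auto simp: card_fifth_roots)
  then obtain c where c: "c \<in> fifth_roots" "c \<noteq> 1" by auto
  then have c5: "c ^ 5 = 1" by (simp add: fifth_roots_def)
  then have c0: "c \<noteq> 0" by auto
  have cj: "c ^ j \<noteq> 1"
  proof
    assume a: "c ^ j = 1"
    from assms consider "j = 1" | "j = 2" | "j = 3" | "j = 4" by blast
    then have "c = 1"
    proof cases
      case 1 then show ?thesis using a by simp
    next
      case 2
      then have "c ^ 2 = 1" using a by simp
      then show ?thesis using c5 by Groebner_Basis.algebra
    next
      case 3
      then have "c ^ 3 = 1" using a by simp
      then show ?thesis using c5 by Groebner_Basis.algebra
    next
      case 4
      then have "c ^ 4 = 1" using a by simp
      then show ?thesis using c5 by Groebner_Basis.algebra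
    qed
    then show False using c by simp
  qed
  have bij: "bij_betw ((*) c) fifth_roots fifth_roots"
    by (rule bij_betwI[of _ _ _ "\<lambda>z. z / c"])
      (use c5 c0 in \<open>auto simp: fifth_roots_def power_mult_distrib power_divide\<close>)
  have "(\<Sum>z\<in>fifth_roots. z ^ j) = (\<Sum>z\<in>fifth_roots. (c * z) ^ j)"
    using sum.reindex_bij_betw[OF bij, of "\<lambda>z. z ^ j"] by simp
  also have "\<dots> = c ^ j * (\<Sum>z\<in>fifth_roots. z ^ j)"
    by (simp add: power_mult_distrib sum_distrib_left)
  finally show ?thesis using cj by simp
qed

lemma sum_fifth_roots_trig_poly:
  "(\<Sum>z\<in>fifth_roots. a + b1 * z + b2 * z^2 + b3 * z^3 + b4 * z^4) = 5 * a"
  using sum_power_fifth_roots[of 1] sum_power_fifth_roots[of 2]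
    sum_power_fifth_roots[of 3] sum_power_fifth_roots[of 4]
  by (simp add: sum.distrib card_fifth_roots flip: sum_distrib_left)

text \<open>
  The coefficients are the squares of the binomial coefficients, as for the mean of
  \<open>\<bar>g + z b\<bar> ^ (2 m)\<close> over the unit circle.  In the proof negative powers of a root are written as
  positive ones by means of \<open>cnj z = z ^ 4\<close>, which turns the powers of \<open>Y z\<close> into polynomials of
  degree at most four.
\<close>

lemma fifth_roots_moments_step:
  fixes g b :: complex
  defines "X \<equiv> (cmod g)\<^sup>2" and "B \<equiv> (cmod b)\<^sup>2"
  defines "Y \<equiv> \<lambda>z. (cmod (g + z * b))\<^sup>2"
  shows "(\<Sum>z\<in>fifth_roots. Y z) = 5 * (X + B)"
    and "(\<Sum>z\<in>fifth_roots. (Y z)\<^sup>2) = 5 * (X\<^sup>2 + 4 * X * B + B\<^sup>2)"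
    and "(\<Sum>z\<in>fifth_roots. (Y z) ^ 3) = 5 * (X ^ 3 + 9 * X\<^sup>2 * B + 9 * X * B\<^sup>2 + B ^ 3)"
    and "(\<Sum>z\<in>fifth_roots. (Y z) ^ 4)
           = 5 * (X ^ 4 + 16 * X ^ 3 * B + 36 * X\<^sup>2 * B\<^sup>2 + 16 * X * B ^ 3 + B ^ 4)"
proof -
  define P :: complex where "P = of_real (X + B)"
  define c where "c = cnj g * b"
  define d where "d = g * cnj b"
  have cd: "c * d = of_real (X * B)"
    unfolding c_def d_def X_def B_def of_real_mult complex_norm_square by (simp add: ac_simps)
  have Y: "of_real (Y z) = P + c * z + d * z ^ 4" if "z \<in> fifth_roots" for z
  proof -
    have "z * cnj z = 1"
      using cmod_fifth_root[OF that] by (simp flip: complex_norm_square)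
    moreover have "z ^ 5 = 1" using that by (simp add: fifth_roots_def)
    ultimately have z: "cnj z = z ^ 4" "z * z ^ 4 = 1" by Groebner_Basis.algebra+
    have "of_real (Y z) = (g + z * b) * cnj (g + z * b)"
      unfolding Y_def by (rule complex_norm_square)
    also have "\<dots> = (g + z * b) * (cnj g + z ^ 4 * cnj b)" by (simp add: z(1))
    also have "\<dots> = g * cnj g + b * cnj b * (z * z ^ 4) + c * z + d * z ^ 4"
      by (simp add: c_def d_def algebra_simps)
    finally show ?thesis unfolding z(2) P_def X_def B_def of_real_add complex_norm_square by simp
  qed
  have eq: "a = b" if "of_real a = (of_real b :: complex)" for a b :: real using that by simp
  have z5: "z ^ 5 = 1" if "z \<in> fifth_roots" for z using that by (simp add: fifth_roots_def)
  show "(\<Sum>z\<in>fifth_roots. Y z) = 5 * (X + B)"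
  proof (rule eq)
    have "of_real (\<Sum>z\<in>fifth_roots. Y z)
        = (\<Sum>z\<in>fifth_roots. P + c * z + 0 * z^2 + 0 * z^3 + d * z^4)"
      unfolding of_real_sum by (rule sum.cong[OF refl]) (simp add: Y)
    then show "of_real (\<Sum>z\<in>fifth_roots. Y z) = (of_real (5 * (X + B)) :: complex)"
      unfolding sum_fifth_roots_trig_poly by (simp add: P_def)
  qed
  show "(\<Sum>z\<in>fifth_roots. (Y z)\<^sup>2) = 5 * (X\<^sup>2 + 4 * X * B + B\<^sup>2)"
  proof (rule eq)
    have "of_real (\<Sum>z\<in>fifth_roots. (Y z)\<^sup>2) = (\<Sum>z\<in>fifth_roots. (P\<^sup>2 + 2 * (c * d))
        + 2 * P * c * z + c\<^sup>2 * z^2 + d\<^sup>2 * z^3 + 2 * P * d * z^4)"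
      unfolding of_real_sum
    proof (rule sum.cong[OF refl])
      fix z assume z: "z \<in> fifth_roots"
      show "of_real ((Y z)\<^sup>2) = (P\<^sup>2 + 2 * (c * d))
        + 2 * P * c * z + c\<^sup>2 * z^2 + d\<^sup>2 * z^3 + 2 * P * d * z^4"
        unfolding of_real_power Y[OF z] using z5[OF z] by Groebner_Basis.algebra
    qed
    then show "of_real (\<Sum>z\<in>fifth_roots. (Y z)\<^sup>2) = (of_real (5 * (X\<^sup>2 + 4 * X * B + B\<^sup>2)) :: complex)"
      unfolding sum_fifth_roots_trig_poly cd by (simp add: P_def power2_eq_square algebra_simps)
  qed
  show "(\<Sum>z\<in>fifth_roots. (Y z) ^ 3) = 5 * (X ^ 3 + 9 * X\<^sup>2 * B + 9 * X * B\<^sup>2 + B ^ 3)"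
  proof (rule eq)
    have "of_real (\<Sum>z\<in>fifth_roots. (Y z) ^ 3) = (\<Sum>z\<in>fifth_roots. (P^3 + 6 * P * (c * d))
        + (3 * P\<^sup>2 * c + 3 * c * (c * d)) * z + (3 * P * c\<^sup>2 + d^3) * z^2
        + (3 * P * d\<^sup>2 + c^3) * z^3 + (3 * P\<^sup>2 * d + 3 * d * (c * d)) * z^4)"
      unfolding of_real_sum
    proof (rule sum.cong[OF refl])
      fix z assume z: "z \<in> fifth_roots"
      show "of_real ((Y z) ^ 3) = (P^3 + 6 * P * (c * d))
        + (3 * P\<^sup>2 * c + 3 * c * (c * d)) * z + (3 * P * c\<^sup>2 + d^3) * z^2
        + (3 * P * d\<^sup>2 + c^3) * z^3 + (3 * P\<^sup>2 * d + 3 * d * (c * d)) * z^4"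
        unfolding of_real_power Y[OF z] using z5[OF z] by Groebner_Basis.algebra
    qed
    then show "of_real (\<Sum>z\<in>fifth_roots. (Y z) ^ 3)
        = (of_real (5 * (X ^ 3 + 9 * X\<^sup>2 * B + 9 * X * B\<^sup>2 + B ^ 3)) :: complex)"
      unfolding sum_fifth_roots_trig_poly cd
      by (simp add: P_def power2_eq_square power3_eq_cube algebra_simps)
  qed
  show "(\<Sum>z\<in>fifth_roots. (Y z) ^ 4)
      = 5 * (X ^ 4 + 16 * X ^ 3 * B + 36 * X\<^sup>2 * B\<^sup>2 + 16 * X * B ^ 3 + B ^ 4)"
  proof (rule eq)
    have "of_real (\<Sum>z\<in>fifth_roots. (Y z) ^ 4)
      = (\<Sum>z\<in>fifth_roots. (P^4 + 12 * P\<^sup>2 * (c * d) + 6 * (c * d)\<^sup>2)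
        + (4 * P^3 * c + 12 * P * c * (c * d) + d^4) * z
        + (6 * P\<^sup>2 * c\<^sup>2 + 4 * c\<^sup>2 * (c * d) + 4 * P * d^3) * z^2
        + (6 * P\<^sup>2 * d\<^sup>2 + 4 * d\<^sup>2 * (c * d) + 4 * P * c^3) * z^3
        + (4 * P^3 * d + 12 * P * d * (c * d) + c^4) * z^4)"
      unfolding of_real_sum
    proof (rule sum.cong[OF refl])
      fix z assume z: "z \<in> fifth_roots"
      show "of_real ((Y z) ^ 4) = (P^4 + 12 * P\<^sup>2 * (c * d) + 6 * (c * d)\<^sup>2)
        + (4 * P^3 * c + 12 * P * c * (c * d) + d^4) * z
        + (6 * P\<^sup>2 * c\<^sup>2 + 4 * c\<^sup>2 * (c * d) + 4 * P * d^3) * z^2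
        + (6 * P\<^sup>2 * d\<^sup>2 + 4 * d\<^sup>2 * (c * d) + 4 * P * c^3) * z^3
        + (4 * P^3 * d + 12 * P * d * (c * d) + c^4) * z^4"
        unfolding of_real_power Y[OF z] using z5[OF z] by Groebner_Basis.algebra
    qed
    then show "of_real (\<Sum>z\<in>fifth_roots. (Y z) ^ 4)
        = (of_real (5 * (X ^ 4 + 16 * X ^ 3 * B + 36 * X\<^sup>2 * B\<^sup>2 + 16 * X * B ^ 3 + B ^ 4)) :: complex)"
      unfolding sum_fifth_roots_trig_poly cd
      by (simp add: P_def power2_eq_square power3_eq_cube power4_eq algebra_simps)
  qed
qed


text \<open>
  If \<open>S = 1\<close> and the coefficients are spread out, then \<open>s\<close>, \<open>t\<close> and \<open>u\<close> are small, and what remains are the moments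
  1, 2, 6, 24 of the exponential distribution, which is the law of the squared modulus of a complex Gaussian.
\<close>

lemma fifth_roots_moments:
  fixes a :: "'a \<Rightarrow> complex"
  assumes "finite X"
  defines "W \<equiv> \<lambda>X. PiE X (\<lambda>_. fifth_roots)"
    and "Y \<equiv> \<lambda>X w. (cmod (\<Sum>x\<in>X. w x * a x))\<^sup>2"
    and "S \<equiv> \<lambda>X. \<Sum>x\<in>X. (cmod (a x))\<^sup>2"
    and "s \<equiv> \<lambda>X. \<Sum>x\<in>X. ((cmod (a x))\<^sup>2)\<^sup>2"
    and "t \<equiv> \<lambda>X. \<Sum>x\<in>X. ((cmod (a x))\<^sup>2) ^ 3"
    and "u \<equiv> \<lambda>X. \<Sum>x\<in>X. ((cmod (a x))\<^sup>2) ^ 4"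
  shows "(\<Sum>w\<in>W X. Y X w) = 5 ^ card X * S X \<and>
    (\<Sum>w\<in>W X. (Y X w)\<^sup>2) = 5 ^ card X * (2 * (S X)\<^sup>2 - s X) \<and>
    (\<Sum>w\<in>W X. (Y X w) ^ 3) = 5 ^ card X * (6 * (S X) ^ 3 - 9 * S X * s X + 4 * t X) \<and>
    (\<Sum>w\<in>W X. (Y X w) ^ 4) = 5 ^ card X *
      (24 * (S X) ^ 4 - 72 * (S X)\<^sup>2 * s X + 64 * S X * t X + 18 * (s X)\<^sup>2 - 33 * u X)"
  using assms(1)
proof (induction X)
  case empty
  then show ?case by (simp add: W_def Y_def S_def s_def t_def u_def)
next
  case (insert x X)
  define B where "B = (cmod (a x))\<^sup>2"
  define K :: real where "K = 5 ^ card X"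
  define M1 where "M1 = (\<Sum>w\<in>W X. Y X w)"
  define M2 where "M2 = (\<Sum>w\<in>W X. (Y X w)\<^sup>2)"
  define M3 where "M3 = (\<Sum>w\<in>W X. (Y X w) ^ 3)"
  define M4 where "M4 = (\<Sum>w\<in>W X. (Y X w) ^ 4)"
  have M0: "real (card (W X)) = K"
    using insert.hyps by (simp add: W_def card_PiE card_fifth_roots K_def)
  have K: "(5 :: real) ^ card (insert x X) = 5 * K" using insert.hyps by (simp add: K_def)
  have Y: "Y (insert x X) (w(x := z)) = (cmod ((\<Sum>y\<in>X. w y * a y) + z * a x))\<^sup>2" for w z
  proof -
    have "(\<Sum>y\<in>X. (w(x := z)) y * a y) = (\<Sum>y\<in>X. w y * a y)"
      using insert.hyps by (intro sum.cong) auto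
    then show ?thesis unfolding Y_def using insert.hyps by (simp add: add.commute)
  qed
  have rec: "(\<Sum>w\<in>W (insert x X). f (Y (insert x X) w))
      = (\<Sum>w\<in>W X. \<Sum>z\<in>fifth_roots. f ((cmod ((\<Sum>y\<in>X. w y * a y) + z * a x))\<^sup>2))" for f :: "real \<Rightarrow> real"
    unfolding W_def using insert.hyps by (subst sum_PiE_insert) (simp_all add: Y)
  have sums: "S (insert x X) = S X + B" "s (insert x X) = s X + B\<^sup>2" "t (insert x X) = t X + B ^ 3"
    "u (insert x X) = u X + B ^ 4"
    using insert.hyps by (simp_all add: S_def s_def t_def u_def B_def)
  have Yf: "(cmod (\<Sum>y\<in>X. w y * a y))\<^sup>2 = Y X w" for w by (simp add: Y_def)
  note lin = sum.distrib sum_distrib_left[symmetric] sum_distrib_right[symmetric]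
  have step1: "(\<Sum>w\<in>W (insert x X). Y (insert x X) w) = 5 * (M1 + K * B)"
    using rec[of "\<lambda>y. y", unfolded fifth_roots_moments_step, folded B_def, unfolded Yf]
    by (simp add: lin M0 M1_def[symmetric])
  have step2: "(\<Sum>w\<in>W (insert x X). (Y (insert x X) w)\<^sup>2) = 5 * (M2 + 4 * M1 * B + K * B\<^sup>2)"
    using rec[of "\<lambda>y. y\<^sup>2", unfolded fifth_roots_moments_step, folded B_def, unfolded Yf]
    by (simp add: lin M0 M1_def[symmetric]
        M2_def[symmetric])
  have step3: "(\<Sum>w\<in>W (insert x X). (Y (insert x X) w) ^ 3)
      = 5 * (M3 + 9 * M2 * B + 9 * M1 * B\<^sup>2 + K * B ^ 3)"
    using rec[of "\<lambda>y. y ^ 3", unfolded fifth_roots_moments_step, folded B_def, unfolded Yf]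
    by (simp add: lin M0 M1_def[symmetric]
        M2_def[symmetric] M3_def[symmetric])
  have step4: "(\<Sum>w\<in>W (insert x X). (Y (insert x X) w) ^ 4)
      = 5 * (M4 + 16 * M3 * B + 36 * M2 * B\<^sup>2 + 16 * M1 * B ^ 3 + K * B ^ 4)"
    using rec[of "\<lambda>y. y ^ 4", unfolded fifth_roots_moments_step, folded B_def, unfolded Yf]
    by (simp add: lin M0 M1_def[symmetric]
        M2_def[symmetric] M3_def[symmetric] M4_def[symmetric])
  have IH: "M1 = K * S X" "M2 = K * (2 * (S X)\<^sup>2 - s X)"
    "M3 = K * (6 * (S X) ^ 3 - 9 * S X * s X + 4 * t X)"
    "M4 = K * (24 * (S X) ^ 4 - 72 * (S X)\<^sup>2 * s X + 64 * S X * t X + 18 * (s X)\<^sup>2 - 33 * u X)"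
    using insert.IH by (simp_all add: M1_def M2_def M3_def M4_def K_def)
  show ?case
    unfolding step1 step2 step3 step4 K sums IH by (intro conjI; Groebner_Basis.algebra)
qed

text \<open>
  For the exponential distribution weighted by \<open>x\<close>, the best cubic majorant of the logarithm touches it at
  the Gauss--Laguerre nodes \<open>3 - \<surd>3\<close> and \<open>3 + \<surd>3\<close>.  The polynomial here touches at 1 and has the
  slope of the logarithm at \<open>7/3\<close> and 4.  This loses little, and only \<open>ln 4\<close> has to be
  estimated: the difference is monotone between the points 1, \<open>7/3\<close> and 4, with minima at 1 and 4.
\<close>

lemma ln_le_cubic:
  assumes "x > 0"
  shows "ln x \<le> (x ^ 3 - 11 * x\<^sup>2 + 47 * x - 37) / (28 :: real)"
proof -
  define g where "g x = (x ^ 3 - 11 * x\<^sup>2 + 47 * x - 37) / 28 - ln x" for x :: real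
  define g' where "g' x = (x - 1) * (3 * x - 7) * (x - 4) / (28 * x)" for x :: real
  have der: "(g has_real_derivative g' x) (at x)" if "x > 0" for x
    unfolding g_def g'_def using that
    by (auto intro!: derivative_eq_intros simp: field_simps power2_eq_square)
  have g1: "g 1 = 0" by (simp add: g_def)
  have "ln (4 :: real) = 2 * ln 2" using ln_realpow[of "2 :: real" 2] by simp
  then have g4: "g 4 \<ge> 0" unfolding g_def using ln2_le_25_over_36 by simp
  have inc: "g a \<le> g b" if "a > 0" "a \<le> b" "\<And>y. a \<le> y \<Longrightarrow> y \<le> b \<Longrightarrow> g' y \<ge> 0" for a b
    by (rule DERIV_nonneg_imp_nondecreasing[OF that(2)]) (meson that der order_less_le_trans)
  have dec: "g b \<le> g a" if "a > 0" "a \<le> b" "\<And>y. a \<le> y \<Longrightarrow> y \<le> b \<Longrightarrow> g' y \<le> 0" for a b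
    by (rule DERIV_nonpos_imp_nonincreasing[OF that(2)]) (meson that der order_less_le_trans)
  consider "x \<le> 1" | "1 \<le> x" "x \<le> 7/3" | "7/3 \<le> x" "x \<le> 4" | "4 \<le> x" by linarith
  then have "g x \<ge> 0"
  proof cases
    case 1
    then have "g 1 \<le> g x" using assms
      by (intro dec[unfolded g'_def] divide_nonpos_pos mult_nonneg_nonpos mult_nonpos_nonpos) auto
    then show ?thesis by (simp add: g1)
  next
    case 2
    then have "g 1 \<le> g x" using assms
      by (intro inc[unfolded g'_def] divide_nonneg_pos mult_nonpos_nonpos mult_nonneg_nonpos) auto
    then show ?thesis by (simp add: g1)
  next
    case 3
    then have "g 4 \<le> g x" using assms
      by (intro dec[unfolded g'_def] divide_nonpos_pos mult_nonneg_nonpos mult_nonneg_nonneg) auto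
    then show ?thesis using g4 by simp
  next
    case 4
    then have "g 4 \<le> g x" using assms by (intro inc) (auto simp: g'_def)
    then show ?thesis using g4 by simp
  qed
  then show ?thesis by (simp add: g_def)
qed

text \<open>
  Jensen's inequality in pointwise form: \<open>x powr (1 - \<delta>) = x exp (- \<delta> ln x)\<close>, the exponential lies above its
  tangent at \<open>- \<delta> L\<close>, and the logarithm lies below the cubic.  In the sum over a distribution
  of mean 1 for which the majorant bounds the entropy by \<open>L\<close>, the terms with a factor \<open>\<delta>\<close>
  contribute something nonnegative.
\<close>

lemma powr_ge_polynomial:
  fixes x \<delta> L :: real
  assumes "x \<ge> 0" "0 \<le> \<delta>"
  shows "exp (- \<delta> * L) * (x + \<delta> * L * x - \<delta> * (x ^ 4 - 11 * x ^ 3 + 47 * x\<^sup>2 - 37 * x) / 28)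
         \<le> x powr (1 - \<delta>)"
proof (cases "x = 0")
  case False
  then have x: "x > 0" using assms by simp
  define Q where "Q = (x ^ 3 - 11 * x\<^sup>2 + 47 * x - 37) / 28"
  have "1 - \<delta> * (Q - L) \<le> 1 + - \<delta> * (ln x - L)"
    using mult_left_mono[OF ln_le_cubic[OF x] assms(2)] by (simp add: Q_def algebra_simps)
  also have "\<dots> \<le> exp (- \<delta> * (ln x - L))" by (rule exp_ge_add_one_self)
  finally have "exp (- \<delta> * L) * x * (1 - \<delta> * (Q - L)) \<le> exp (- \<delta> * L) * x * exp (- \<delta> * (ln x - L))"
    using x by (intro mult_left_mono) auto
  also have "\<dots> = x * exp (- \<delta> * ln x)"
    by (simp add: algebra_simps flip: exp_add)
  also have "\<dots> = x powr (1 - \<delta>)"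
    using x by (simp add: powr_def algebra_simps exp_diff exp_minus field_simps)
  finally show ?thesis
    by (simp add: Q_def power2_eq_square power3_eq_cube power4_eq field_simps)
qed simp

text \<open>
  The polynomial is 28 times the majorant of \<open>x ln x\<close>, so the entropy is at most \<open>15/28\<close>.  By the
  moment formulas the mean is \<open>15 - 20 s + 20 t + 18 s\<^sup>2 - 33 u\<close>, which is largest in the limit of spread
  out coefficients: \<open>s\<^sup>2 \<le> t\<close> by the Cauchy--Schwarz inequality, and \<open>20 s - 38 t + 33 u\<close> is the sum of
  \<open>B\<^sup>2 (20 - 38 B + 33 B\<^sup>2)\<close> with a quadratic factor that has no real zero.
\<close>

lemma fifth_roots_entropy:
  fixes a :: "'a \<Rightarrow> complex"
  assumes "finite X" and one: "(\<Sum>x\<in>X. (cmod (a x))\<^sup>2) = 1"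
  defines "Y \<equiv> \<lambda>w. (cmod (\<Sum>x\<in>X. w x * a x))\<^sup>2"
  shows "(\<Sum>w\<in>PiE X (\<lambda>_. fifth_roots). Y w ^ 4 - 11 * Y w ^ 3 + 47 * (Y w)\<^sup>2 - 37 * Y w)
         \<le> 15 * 5 ^ card X"
proof -
  define B where "B x = (cmod (a x))\<^sup>2" for x
  define s where "s = (\<Sum>x\<in>X. (B x)\<^sup>2)"
  define t where "t = (\<Sum>x\<in>X. B x ^ 3)"
  define u where "u = (\<Sum>x\<in>X. B x ^ 4)"
  have Yf: "(cmod (\<Sum>x\<in>X. w x * a x))\<^sup>2 = Y w" for w by (simp add: Y_def)
  note M = fifth_roots_moments[OF assms(1), of a, folded B_def, folded s_def t_def u_def,
      unfolded one[folded B_def] Yf]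
  have "0 \<le> (\<Sum>x\<in>X. B x * (B x - s)\<^sup>2)" by (intro sum_nonneg) (simp add: B_def)
  also have "\<dots> = (\<Sum>x\<in>X. B x ^ 3 - 2 * s * (B x)\<^sup>2 + s\<^sup>2 * B x)"
    by (intro sum.cong refl) Groebner_Basis.algebra
  also have "\<dots> = t - s\<^sup>2"
    unfolding sum.distrib sum_subtractf sum_distrib_left[symmetric] s_def[symmetric] t_def[symmetric]
    using one[folded B_def] by (simp add: power2_eq_square)
  finally have st: "s\<^sup>2 \<le> t" by simp
  have "0 \<le> (\<Sum>x\<in>X. (B x)\<^sup>2 * (33 * (B x - 19/33)\<^sup>2 + 299/33))"
    by (intro sum_nonneg mult_nonneg_nonneg add_nonneg_nonneg) auto
  also have "\<dots> = (\<Sum>x\<in>X. 20 * (B x)\<^sup>2 - 38 * B x ^ 3 + 33 * B x ^ 4)"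
    by (intro sum.cong refl) (simp add: power2_eq_square power3_eq_cube power4_eq algebra_simps)
  also have "\<dots> = 20 * s - 38 * t + 33 * u"
    by (simp add: sum.distrib sum_subtractf s_def t_def u_def flip: sum_distrib_left)
  finally have "0 \<le> 20 * s - 38 * t + 33 * u" .
  with st have "15 - 20 * s + 20 * t + 18 * s\<^sup>2 - 33 * u \<le> 15" by linarith
  then have "5 ^ card X * (15 - 20 * s + 20 * t + 18 * s\<^sup>2 - 33 * u) \<le> 5 ^ card X * 15"
    by (intro mult_left_mono) auto
  moreover have "(\<Sum>w\<in>PiE X (\<lambda>_. fifth_roots). Y w ^ 4 - 11 * Y w ^ 3 + 47 * (Y w)\<^sup>2 - 37 * Y w)
      = 5 ^ card X * (15 - 20 * s + 20 * t + 18 * s\<^sup>2 - 33 * u)"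
    using M by (simp add: sum.distrib sum_subtractf flip: sum_distrib_left) (simp add: algebra_simps)
  ultimately show ?thesis by simp
qed

lemma fifth_roots_Khinchine:
  fixes a :: "'a \<Rightarrow> complex"
  assumes fin: "finite X" and \<delta>: "0 \<le> \<delta>"
  shows "exp (- \<delta> * (15/28)) * (\<Sum>x\<in>X. (cmod (a x))\<^sup>2) powr (1 - \<delta>) * 5 ^ card X
    \<le> (\<Sum>w\<in>PiE X (\<lambda>_. fifth_roots). (cmod (\<Sum>x\<in>X. w x * a x))\<^sup>2 powr (1 - \<delta>))"
proof -
  define S where "S = (\<Sum>x\<in>X. (cmod (a x))\<^sup>2)"
  have "S \<ge> 0" unfolding S_def by (intro sum_nonneg) auto
  show ?thesis
  proof (cases "S = 0")
    case True
    then show ?thesis by (simp add: S_def[symmetric] sum_nonneg)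
  next
    case False
    with \<open>S \<ge> 0\<close> have S: "S > 0" by simp
    define b where "b x = a x / of_real (sqrt S)" for x
    define Y where "Y w = (cmod (\<Sum>x\<in>X. w x * b x))\<^sup>2" for w
    have Y0: "Y w \<ge> 0" for w by (simp add: Y_def)
    have aY: "(cmod (\<Sum>x\<in>X. w x * a x))\<^sup>2 = S * Y w" for w
    proof -
      have "(\<Sum>x\<in>X. w x * b x) = (\<Sum>x\<in>X. w x * a x) / of_real (sqrt S)"
        by (simp add: b_def sum_divide_distrib)
      then show ?thesis using S by (simp add: Y_def norm_divide power_divide)
    qed
    have one: "(\<Sum>x\<in>X. (cmod (b x))\<^sup>2) = 1"
      using S by (simp add: b_def norm_divide power_divide S_def[symmetric] flip: sum_divide_distrib)
    define K :: real where "K = 5 ^ card X"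
    define P where "P w = Y w ^ 4 - 11 * Y w ^ 3 + 47 * (Y w)\<^sup>2 - 37 * Y w" for w
    let ?W = "PiE X (\<lambda>_. fifth_roots)"
    have P: "(\<Sum>w\<in>?W. P w) \<le> 15 * K"
      unfolding P_def Y_def K_def using fifth_roots_entropy[OF fin one] .
    have Y: "(\<Sum>w\<in>?W. Y w) = K"
      using fifth_roots_moments[OF fin, of b] one by (simp add: Y_def K_def)
    have "exp (- \<delta> * (15/28)) * K
        \<le> exp (- \<delta> * (15/28)) * (K + \<delta> * (15/28) * K - \<delta> * (\<Sum>w\<in>?W. P w) / 28)"
      using mult_left_mono[OF P \<delta>] by (intro mult_left_mono) auto
    also have "\<dots> = (\<Sum>w\<in>?W. exp (- \<delta> * (15/28)) * (Y w + \<delta> * (15/28) * Y w - \<delta> * P w / 28))"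
      unfolding Y[symmetric]
      by (simp only: sum_distrib_left sum.distrib sum_subtractf sum_divide_distrib
          right_diff_distrib distrib_left)
    also have "\<dots> \<le> (\<Sum>w\<in>?W. Y w powr (1 - \<delta>))"
      unfolding P_def using Y0 \<delta> by (intro sum_mono powr_ge_polynomial)
    finally have "S powr (1 - \<delta>) * (exp (- \<delta> * (15/28)) * K)
        \<le> S powr (1 - \<delta>) * (\<Sum>w\<in>?W. Y w powr (1 - \<delta>))"
      by (intro mult_left_mono) auto
    then show ?thesis
      using S Y0 by (simp add: aY powr_mult S_def[symmetric] K_def sum_distrib_left ac_simps)
  qed
qed

section \<open>Multilinear forms and the Bohnenblust--Hille inequality\<close>

text \<open>
  Arbitrary finite index sets in place of \<open>{..<n}\<close> make fixing one variable stay within the same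
  notion, without renumbering the others.
\<close>

definition multilinear_on :: "nat set \<Rightarrow> nat \<Rightarrow> ((nat \<Rightarrow> complex Matrix.vec) \<Rightarrow> complex) \<Rightarrow> bool" where
  "multilinear_on A N U \<longleftrightarrow>
     (\<forall>z \<in> A \<rightarrow>\<^sub>E carrier_vec N. \<forall>k\<in>A.
        (\<forall>x \<in> carrier_vec N. \<forall>y \<in> carrier_vec N.
           U (z(k := x + y)) = U (z(k := x)) + U (z(k := y))) \<and>
        (\<forall>a. \<forall>x \<in> carrier_vec N. U (z(k := a \<cdot>\<^sub>v x)) = a * U (z(k := x))))"

lemma multilinear_form_iff: "multilinear_form n N U \<longleftrightarrow> multilinear_on {..<n} N U"
  unfolding multilinear_form_def multilinear_on_def by (simp only: Ball_def lessThan_iff)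

definition closed_polydisc :: "nat \<Rightarrow> complex Matrix.vec set" where
  "closed_polydisc N = {z \<in> carrier_vec N. \<forall>i<N. cmod (vec_index z i) \<le> 1}"

lemma PiE_fun_upd': "z \<in> PiE (A - {j}) I \<Longrightarrow> j \<in> A \<Longrightarrow> v \<in> I j \<Longrightarrow> z(j := v) \<in> PiE A I"
  by (auto simp: PiE_iff extensional_def)

lemma multilinear_on_add:
  assumes "multilinear_on A N U" "j \<in> A" "z \<in> (A - {j}) \<rightarrow>\<^sub>E carrier_vec N"
    "x \<in> carrier_vec N" "y \<in> carrier_vec N"
  shows "U (z(j := x + y)) = U (z(j := x)) + U (z(j := y))"
  using assms PiE_fun_upd'[OF assms(3,2,4)] unfolding multilinear_on_def
  by (metis (no_types, lifting) fun_upd_upd)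

lemma multilinear_on_smult:
  assumes "multilinear_on A N U" "j \<in> A" "z \<in> (A - {j}) \<rightarrow>\<^sub>E carrier_vec N" "x \<in> carrier_vec N"
  shows "U (z(j := a \<cdot>\<^sub>v x)) = a * U (z(j := x))"
  using assms PiE_fun_upd'[OF assms(3,2,4)] unfolding multilinear_on_def
  by (metis (no_types, lifting) fun_upd_upd)

lemma multilinear_on_expand:
  assumes U: "multilinear_on A N U" "j \<in> A" "z \<in> (A - {j}) \<rightarrow>\<^sub>E carrier_vec N"
  shows "U (z(j := Matrix.vec N w)) = (\<Sum>x<N. w x * U (z(j := unit_vec N x)))"
proof -
  have "U (z(j := Matrix.vec N (\<lambda>x. if x < r then w x else 0))) = (\<Sum>x<r. w x * U (z(j := unit_vec N x)))"
    if "r \<le> N" for r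
    using that
  proof (induction r)
    case 0
    define v where "v = Matrix.vec N (\<lambda>x. 0 :: complex)"
    have "v = 0 \<cdot>\<^sub>v v" unfolding v_def by (intro eq_vecI) auto
    moreover have "U (z(j := 0 \<cdot>\<^sub>v v)) = 0 * U (z(j := v))"
      by (rule multilinear_on_smult[OF U]) (simp add: v_def)
    ultimately have "U (z(j := v)) = 0" by simp
    then show ?case unfolding v_def by (simp only: not_less0 if_False lessThan_0 sum.empty)
  next
    case (Suc r)
    have "Matrix.vec N (\<lambda>x. if x < Suc r then w x else 0)
        = Matrix.vec N (\<lambda>x. if x < r then w x else 0) + w r \<cdot>\<^sub>v unit_vec N r"
      using Suc.prems by (intro eq_vecI) (auto simp: less_Suc_eq)
    moreover have "U (z(j := Matrix.vec N (\<lambda>x. if x < r then w x else 0) + w r \<cdot>\<^sub>v unit_vec N r))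
        = U (z(j := Matrix.vec N (\<lambda>x. if x < r then w x else 0))) + U (z(j := w r \<cdot>\<^sub>v unit_vec N r))"
      by (rule multilinear_on_add[OF U]) auto
    moreover have "U (z(j := w r \<cdot>\<^sub>v unit_vec N r)) = w r * U (z(j := unit_vec N r))"
      by (rule multilinear_on_smult[OF U]) auto
    moreover have "U (z(j := Matrix.vec N (\<lambda>x. if x < r then w x else 0)))
        = (\<Sum>x<r. w x * U (z(j := unit_vec N x)))"
      using Suc.IH Suc.prems Suc_leD by blast
    ultimately show ?case by (simp only: sum.lessThan_Suc)
  qed
  from this[of N] have "U (z(j := Matrix.vec N (\<lambda>x. if x < N then w x else 0)))
      = (\<Sum>x<N. w x * U (z(j := unit_vec N x)))" by simp
  moreover have "Matrix.vec N (\<lambda>x. if x < N then w x else 0) = Matrix.vec N w" by (intro eq_vecI) auto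
  ultimately show ?thesis by simp
qed

lemma multilinear_on_slice:
  assumes U: "multilinear_on A N U" and j: "j \<in> A" and v: "v \<in> carrier_vec N"
  shows "multilinear_on (A - {j}) N (\<lambda>z. U (z(j := v)))"
  unfolding multilinear_on_def
proof (intro ballI conjI allI)
  fix z :: "nat \<Rightarrow> complex Matrix.vec" and k
  assume z: "z \<in> (A - {j}) \<rightarrow>\<^sub>E carrier_vec N" and k: "k \<in> A - {j}"
  have zj: "z(j := v) \<in> A \<rightarrow>\<^sub>E carrier_vec N" by (rule PiE_fun_upd'[OF z j v])
  have sw: "(z(k := x))(j := v) = (z(j := v))(k := x)" for x using k by (auto simp: fun_eq_iff)
  have kA: "k \<in> A" using k by simp
  note 1 = U[unfolded multilinear_on_def, rule_format, OF zj kA]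
  show "U ((z(k := x + y))(j := v)) = U ((z(k := x))(j := v)) + U ((z(k := y))(j := v))"
    if "x \<in> carrier_vec N" "y \<in> carrier_vec N" for x y
    unfolding sw using 1 that by blast
  show "U ((z(k := a \<cdot>\<^sub>v x))(j := v)) = a * U ((z(k := x))(j := v))"
    if "x \<in> carrier_vec N" for x a
    unfolding sw using 1 that by blast
qed

text \<open>
  The supremum over a set that is not bounded above would be an arbitrary real number, so
  this is what gives the supremum in the Bohnenblust--Hille inequality its meaning.
\<close>

lemma multilinear_on_bounded:
  assumes "finite A" "multilinear_on A N U"
  shows "\<exists>M. \<forall>z \<in> A \<rightarrow>\<^sub>E closed_polydisc N. cmod (U z) \<le> M"
  using assms
proof (induction A arbitrary: U)
  case empty
  then show ?case by auto
next
  case (insert j A)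
  have A: "insert j A - {j} = A" using insert.hyps by auto
  have "\<exists>M. \<forall>z \<in> A \<rightarrow>\<^sub>E closed_polydisc N. cmod (U (z(j := unit_vec N x))) \<le> M" for x
    using multilinear_on_slice[OF insert.prems insertI1 unit_vec_carrier] unfolding A
    by (rule insert.IH)
  then obtain M where M: "\<And>x z. z \<in> A \<rightarrow>\<^sub>E closed_polydisc N \<Longrightarrow> cmod (U (z(j := unit_vec N x))) \<le> M x"
    by metis
  have "cmod (U z) \<le> (\<Sum>x<N. M x)" if z: "z \<in> insert j A \<rightarrow>\<^sub>E closed_polydisc N" for z
  proof -
    define y where "y = restrict z A"
    have y: "y \<in> A \<rightarrow>\<^sub>E closed_polydisc N" using z by (auto simp: y_def PiE_iff)
    then have y': "y \<in> (insert j A - {j}) \<rightarrow>\<^sub>E carrier_vec N"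
      unfolding A by (auto simp: PiE_iff closed_polydisc_def)
    have zj: "z j \<in> carrier_vec N" "\<And>x. x < N \<Longrightarrow> cmod (vec_index (z j) x) \<le> 1"
      using z by (auto simp: closed_polydisc_def PiE_iff)
    have "z = y(j := Matrix.vec N (\<lambda>x. vec_index (z j) x))"
      using z zj(1) insert.hyps
      by (auto simp: y_def fun_eq_iff PiE_iff extensional_def intro!: eq_vecI)
    then have "U z = (\<Sum>x<N. vec_index (z j) x * U (y(j := unit_vec N x)))"
      using multilinear_on_expand[OF insert.prems insertI1 y'] by metis
    also have "cmod \<dots> \<le> (\<Sum>x<N. cmod (vec_index (z j) x * U (y(j := unit_vec N x))))"
      by (rule norm_sum)
    also have "\<dots> \<le> (\<Sum>x<N. 1 * M x)"
      unfolding norm_mult using M[OF y] zj(2) by (intro sum_mono mult_mono) auto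
    finally show ?thesis by simp
  qed
  then show ?case by blast
qed

lemma multilinear_on_scale:
  assumes "finite A" and U: "multilinear_on A N U" and z: "z \<in> A \<rightarrow>\<^sub>E carrier_vec N"
  shows "U (\<lambda>k\<in>A. r \<cdot>\<^sub>v z k) = r ^ card A * U z"
proof -
  have "U (\<lambda>k\<in>A. if k \<in> B then r \<cdot>\<^sub>v z k else z k) = r ^ card B * U z" if "finite B" "B \<subseteq> A" for B
    using that
  proof (induction B)
    case empty
    have "(\<lambda>k\<in>A. z k) = z" using z by (metis PiE_restrict)
    then show ?case by simp
  next
    case (insert b B)
    define y where "y = (\<lambda>k\<in>A. if k \<in> B then r \<cdot>\<^sub>v z k else z k)"
    have y: "y \<in> A \<rightarrow>\<^sub>E carrier_vec N" using z by (auto simp: y_def)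
    have b: "b \<in> A" "b \<notin> B" "z b \<in> carrier_vec N" using insert z by auto
    have "(\<lambda>k\<in>A. if k \<in> insert b B then r \<cdot>\<^sub>v z k else z k) = y(b := r \<cdot>\<^sub>v z b)"
      using b by (auto simp: y_def fun_eq_iff)
    moreover have "y(b := z b) = y" using b by (auto simp: y_def fun_eq_iff)
    moreover have "U (y(b := r \<cdot>\<^sub>v z b)) = r * U (y(b := z b))"
      using U y b unfolding multilinear_on_def by blast
    moreover have "U y = r ^ card B * U z" using insert.IH insert.prems unfolding y_def by blast
    ultimately show ?case using insert.hyps by (simp only: card_insert_disjoint power_Suc mult.assoc not_False_eq_True)
  qed
  from this[of A] have "U (\<lambda>k\<in>A. if k \<in> A then r \<cdot>\<^sub>v z k else z k) = r ^ card A * U z"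
    using assms(1) by simp
  moreover have "(\<lambda>k\<in>A. if k \<in> A then r \<cdot>\<^sub>v z k else z k) = (\<lambda>k\<in>A. r \<cdot>\<^sub>v z k)"
    by (auto simp: fun_eq_iff)
  ultimately show ?thesis by simp
qed

text \<open>
  Unimodular vectors lie on the boundary of the open polydisc; shrinking them by a factor \<open>r < 1\<close>
  changes the form by the factor \<open>r ^ card A\<close> only, and \<open>r\<close> may tend to 1.
\<close>

lemma multilinear_on_le_SUP:
  assumes A: "finite A" and U: "multilinear_on A N U" and z: "z \<in> A \<rightarrow>\<^sub>E closed_polydisc N"
  shows "cmod (U z) \<le> (SUP z \<in> A \<rightarrow>\<^sub>E open_polydisc N. cmod (U z))" (is "_ \<le> ?S")
proof -
  obtain M where M: "\<And>z. z \<in> A \<rightarrow>\<^sub>E closed_polydisc N \<Longrightarrow> cmod (U z) \<le> M"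
    using multilinear_on_bounded[OF A U] by blast
  have "open_polydisc N \<subseteq> closed_polydisc N"
    by (auto simp: open_polydisc_def closed_polydisc_def intro: less_imp_le)
  then have "(A \<rightarrow>\<^sub>E open_polydisc N) \<subseteq> (A \<rightarrow>\<^sub>E closed_polydisc N)" by (intro PiE_mono) auto
  then have bdd: "bdd_above ((\<lambda>z. cmod (U z)) ` (A \<rightarrow>\<^sub>E open_polydisc N))"
    using M by (intro bdd_aboveI2[of _ _ M]) auto
  have zc: "z \<in> A \<rightarrow>\<^sub>E carrier_vec N" using z by (auto simp: closed_polydisc_def PiE_iff)
  have r: "r ^ card A * cmod (U z) \<le> ?S" if "0 < r" "r < 1" for r :: real
  proof -
    have "cmod (of_real r * vec_index (z k) i) < 1" if "k \<in> A" "i < N" for k i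
    proof -
      have "cmod (vec_index (z k) i) \<le> 1" using z that by (auto simp: closed_polydisc_def PiE_iff)
      then have "r * cmod (vec_index (z k) i) \<le> r * 1"
        using \<open>0 < r\<close> by (intro mult_left_mono) auto
      then have "r * cmod (vec_index (z k) i) < 1" using \<open>r < 1\<close> by linarith
      then show ?thesis using \<open>0 < r\<close> by (simp add: norm_mult)
    qed
    then have "(\<lambda>k\<in>A. of_real r \<cdot>\<^sub>v z k) \<in> A \<rightarrow>\<^sub>E open_polydisc N"
      using zc by (auto simp: open_polydisc_def PiE_iff)
    from cSUP_upper[OF this bdd] show ?thesis
      using multilinear_on_scale[OF A U zc, of "of_real r"] \<open>0 < r\<close> by (simp add: norm_mult norm_power)
  qed
  have "((\<lambda>r :: real. r ^ card A * cmod (U z)) \<longlongrightarrow> 1 ^ card A * cmod (U z)) (at_left 1)"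
    by (intro tendsto_intros)
  moreover have "eventually (\<lambda>r :: real. r ^ card A * cmod (U z) \<le> ?S) (at_left 1)"
    using eventually_at_left_real[of 0 "1 :: real"] by (rule eventually_mono) (use r in auto)
  ultimately have "1 ^ card A * cmod (U z) \<le> ?S"
    by (intro tendsto_upperbound) auto
  then show ?thesis by simp
qed

lemma power2_powr: "x \<ge> 0 \<Longrightarrow> (x\<^sup>2) powr a = x powr (2 * a)" for x a :: real
  by (cases "x = 0") (simp_all add: powr_powr flip: powr_numeral)

lemma powr_prod_const_le:
  fixes T :: "'a \<Rightarrow> real"
  assumes "\<And>j. j \<in> A \<Longrightarrow> 0 \<le> T j" "\<And>j. j \<in> A \<Longrightarrow> T j \<le> D" "D > 0" "e \<ge> 0"
  shows "(\<Prod>j\<in>A. T j powr e) \<le> D powr (real (card A) * e)"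
proof -
  have "(\<Prod>j\<in>A. T j powr e) \<le> (\<Prod>j\<in>A. D powr e)"
    using assms by (intro prod_mono conjI powr_mono2) auto
  also have "\<dots> = D powr (real (card A) * e)"
    using assms(3) by (simp add: powr_powr powr_realpow[symmetric] mult.commute)
  finally show ?thesis .
qed

definition basis_tuple :: "nat set \<Rightarrow> nat \<Rightarrow> (nat \<Rightarrow> nat) \<Rightarrow> nat \<Rightarrow> complex Matrix.vec" where
  "basis_tuple A N i = (\<lambda>k\<in>A. unit_vec N (i k))"

lemma basis_tuple_upd: "j \<in> A \<Longrightarrow> basis_tuple A N (i(j := x)) = (basis_tuple (A - {j}) N i)(j := unit_vec N x)"
  by (auto simp: basis_tuple_def fun_eq_iff)

lemma basis_tuple_carrier: "basis_tuple A N i \<in> A \<rightarrow>\<^sub>E carrier_vec N"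
  by (auto simp: basis_tuple_def)

text \<open>
  The sum over the variable \<open>j\<close> of squared coefficients is replaced, for every choice of the other
  indices, by an average over random vectors \<open>w\<close> in that variable; exchanging the
  two sums leaves slices of the form, to which the bound \<open>D\<close> applies.
\<close>

lemma mixed_norm_step:
  fixes U N A and p :: real
  assumes A: "finite A" "j \<in> A" and U: "multilinear_on A N U" and p: "p = 2 * (1 - \<delta>)" "\<delta> \<ge> 0"
    and slice: "\<And>v. v \<in> closed_polydisc N \<Longrightarrow>
       (\<Sum>i\<in>(A - {j}) \<rightarrow>\<^sub>E {..<N}. cmod (U ((basis_tuple (A - {j}) N i)(j := v))) powr p) \<le> D"
  shows "(\<Sum>i\<in>(A - {j}) \<rightarrow>\<^sub>E {..<N}. (\<Sum>x<N. (cmod (U (basis_tuple A N (i(j := x)))))\<^sup>2) powr (1 - \<delta>))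
         \<le> exp (\<delta> * (15/28)) * D"
proof -
  let ?I = "(A - {j}) \<rightarrow>\<^sub>E {..<N}"
  let ?W = "PiE {..<N} (\<lambda>_. fifth_roots)"
  define a where "a i x = U (basis_tuple A N (i(j := x)))" for i x
  define E where "E = exp (- \<delta> * (15/28))"
  have E: "E > 0" "exp (\<delta> * (15/28)) = 1 / E" by (simp_all add: E_def exp_minus field_simps)
  have "E * (\<Sum>i\<in>?I. (\<Sum>x<N. (cmod (a i x))\<^sup>2) powr (1 - \<delta>)) * 5 ^ N
      = (\<Sum>i\<in>?I. E * (\<Sum>x<N. (cmod (a i x))\<^sup>2) powr (1 - \<delta>) * 5 ^ N)"
    by (simp add: sum_distrib_left sum_distrib_right)
  also have "\<dots> \<le> (\<Sum>i\<in>?I. \<Sum>w\<in>?W. (cmod (\<Sum>x<N. w x * a i x))\<^sup>2 powr (1 - \<delta>))"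
    unfolding E_def using fifth_roots_Khinchine[of "{..<N}" \<delta>] p(2) by (intro sum_mono) auto
  also have "\<dots> = (\<Sum>w\<in>?W. \<Sum>i\<in>?I. (cmod (\<Sum>x<N. w x * a i x))\<^sup>2 powr (1 - \<delta>))"
    by (rule sum.swap)
  also have "\<dots> \<le> (\<Sum>w\<in>?W. D)"
  proof (rule sum_mono)
    fix w assume w: "w \<in> ?W"
    have "Matrix.vec N w \<in> closed_polydisc N"
      using w cmod_fifth_root by (force simp: closed_polydisc_def PiE_iff)
    from slice[OF this] show "(\<Sum>i\<in>?I. (cmod (\<Sum>x<N. w x * a i x))\<^sup>2 powr (1 - \<delta>)) \<le> D"
      by (simp add: multilinear_on_expand[OF U A(2) basis_tuple_carrier] a_def basis_tuple_upd[OF A(2)]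
          power2_powr p(1))
  qed
  also have "\<dots> = D * 5 ^ N" by (simp add: card_PiE card_fifth_roots)
  finally have "E * (\<Sum>i\<in>?I. (\<Sum>x<N. (cmod (a i x))\<^sup>2) powr (1 - \<delta>)) \<le> D" by simp
  then show ?thesis unfolding E(2) a_def using E(1) by (simp add: field_simps)
qed

text \<open>
  For one variable the exponent is 1, and the
  sum is attained at the vector of phases conjugate to the coefficients.  In the step the Khinchine loss
  is \<open>exp (15/28 \<delta>)\<close> on the \<open>p\<close>-th power of the bound, that is \<open>exp (15/56 / (m + 1))\<close> on the bound
  itself, so that the losses add up to a harmonic number.
\<close>

theorem multilinear_BH:
  assumes "finite A" "card A = Suc m" "multilinear_on A N U" "M > 0"
    and "\<And>z. z \<in> A \<rightarrow>\<^sub>E closed_polydisc N \<Longrightarrow> cmod (U z) \<le> M"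
  shows "(\<Sum>i \<in> A \<rightarrow>\<^sub>E {..<N}. cmod (U (basis_tuple A N i)) powr (2 * real (Suc m) / real (m + 2)))
         \<le> (exp (15/56 * harm m) * M) powr (2 * real (Suc m) / real (m + 2))"
  using assms
proof (induction m arbitrary: A U)
  case 0
  then obtain a where a: "A = {a}" by (auto simp: card_Suc_eq)
  define z :: "nat \<Rightarrow> complex Matrix.vec" where "z = (\<lambda>_. undefined)"
  define c where "c x = U (z(a := unit_vec N x))" for x
  define w where "w x = cnj (sgn (c x))" for x
  have wc: "w x * c x = of_real (cmod (c x))" for x
  proof (cases "c x = 0")
    case False
    have "w x * c x = of_real ((cmod (c x))\<^sup>2) / of_real (cmod (c x))"
      unfolding complex_norm_square by (simp add: w_def sgn_eq)
    then show ?thesis using False by (simp add: power2_eq_square)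
  qed (simp add: w_def)
  have z: "z \<in> (A - {a}) \<rightarrow>\<^sub>E carrier_vec N" by (auto simp: a z_def)
  have "(\<Sum>i \<in> A \<rightarrow>\<^sub>E {..<N}. cmod (U (basis_tuple A N i)) powr 1) = (\<Sum>x<N. cmod (c x))"
    unfolding a using sum_PiE_insert[of a "{}" "\<lambda>i. cmod (U (basis_tuple {a} N i))" "\<lambda>_. {..<N}"]
    by (simp add: c_def z_def basis_tuple_def restrict_def fun_upd_def cong: if_cong)
  also have "of_real (\<Sum>x<N. cmod (c x)) = U (z(a := Matrix.vec N w))"
    using multilinear_on_expand[OF 0(3) _ z, of w, folded c_def] a
    by (simp only: of_real_sum wc insertI1)
  then have "(\<Sum>x<N. cmod (c x)) = cmod (U (z(a := Matrix.vec N w)))"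
    by (metis abs_of_nonneg norm_ge_zero norm_of_real sum_nonneg)
  also have "\<dots> \<le> M"
    by (rule 0(5)) (auto simp: a z_def w_def closed_polydisc_def PiE_iff extensional_def norm_sgn)
  finally show ?case using 0(4) by (simp add: harm_def)
next
  case (Suc m)
  define p where "p = 2 * real (Suc m) / real (m + 2)"
  define \<delta> where "\<delta> = 1 / real (m + 2)"
  define D where "D = (exp (15/56 * harm (Suc m)) * M) powr p"
  define u where "u i = (cmod (U (basis_tuple A N i)))\<^sup>2" for i
  define T where "T j = (\<Sum>i\<in>(A - {j}) \<rightarrow>\<^sub>E {..<N}. (\<Sum>x<N. u (i(j := x))) powr (1 - \<delta>))" for j
  have p: "p = 2 * (1 - \<delta>)" "\<delta> \<ge> 0" "1 - \<delta> = real (Suc m) / real (Suc (Suc m))"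
    by (simp_all add: p_def \<delta>_def field_simps)
  have D: "D > 0" using Suc.prems(4) by (simp add: D_def)
  have D': "D = exp (\<delta> * (15/28)) * (exp (15/56 * harm m) * M) powr p"
  proof -
    have "exp (15/56 * harm (Suc m)) * M = exp (15/56 / real (Suc m)) * (exp (15/56 * harm m) * M)"
      by (simp add: harm_Suc field_simps flip: exp_add)
    moreover have "exp (15/56 / real (Suc m)) powr p = exp (\<delta> * (15/28))"
      by (simp add: powr_def p_def \<delta>_def field_simps del: of_nat_Suc of_nat_add)
    ultimately show ?thesis unfolding D_def using Suc.prems(4) by (simp add: powr_mult)
  qed
  have T: "T j \<le> D" if j: "j \<in> A" for j
    unfolding T_def u_def D'
  proof (rule mixed_norm_step[OF Suc.prems(1) j Suc.prems(3) p(1,2)])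
    fix v assume v: "v \<in> closed_polydisc N"
    then have vc: "v \<in> carrier_vec N" by (simp add: closed_polydisc_def)
    show "(\<Sum>i\<in>(A - {j}) \<rightarrow>\<^sub>E {..<N}. cmod (U ((basis_tuple (A - {j}) N i)(j := v))) powr p)
        \<le> (exp (15/56 * harm m) * M) powr p"
      unfolding p_def
    proof (rule Suc.IH)
      show "multilinear_on (A - {j}) N (\<lambda>z. U (z(j := v)))"
        by (rule multilinear_on_slice[OF Suc.prems(3) j vc])
      show "cmod (U (z(j := v))) \<le> M" if "z \<in> (A - {j}) \<rightarrow>\<^sub>E closed_polydisc N" for z
        by (rule Suc.prems(5)[OF PiE_fun_upd'[OF that j v]])
    qed (use Suc.prems j in auto)
  qed
  define n where "n = real m + 2"
  have n: "n > 1" "real (Suc m) = n - 1" "real (Suc (Suc m)) = n" "real (Suc m + 2) = n + 1"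
    "real (m + 2) = n" by (simp_all add: n_def)
  have "(\<Sum>i \<in> A \<rightarrow>\<^sub>E {..<N}. cmod (U (basis_tuple A N i)) powr (2 * real (Suc (Suc m)) / real (Suc m + 2)))
      = (\<Sum>i \<in> A \<rightarrow>\<^sub>E {..<N}. u i powr (real (Suc (Suc m)) / real (Suc m + 2)))"
    by (simp add: u_def power2_powr)
  also have "\<dots> \<le> (\<Prod>j\<in>A. T j powr (real (Suc (Suc m)) / (real (Suc m) * real (Suc m + 2))))"
    unfolding T_def p(3) using Suc.prems by (intro Blei_mixed_norm) (auto simp: u_def)
  also have "\<dots> \<le> D powr (real (card A) * (real (Suc (Suc m)) / (real (Suc m) * real (Suc m + 2))))"
    using T D by (intro powr_prod_const_le) (auto simp: T_def intro: sum_nonneg)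
  also have "\<dots> = (exp (15/56 * harm (Suc m)) * M) powr (2 * real (Suc (Suc m)) / real (Suc m + 2))"
  proof -
    have "p * (real (card A) * (real (Suc (Suc m)) / (real (Suc m) * real (Suc m + 2))))
        = 2 * real (Suc (Suc m)) / real (Suc m + 2)"
      unfolding p_def Suc.prems(2) n using n(1) by (simp add: divide_simps)
    then show ?thesis unfolding D_def powr_powr by simp
  qed
  finally show ?case .
qed

theorem bohnenblust_hille_exp_harm:
  assumes "n \<ge> 1"
  shows "bohnenblust_hille n (exp (15/56 * harm (n - 1)))"
  unfolding bohnenblust_hille_def multilinear_form_iff
proof (intro allI impI)
  fix N :: nat and U assume N: "N \<ge> 1" and U: "multilinear_on {..<n} N U"
  define S where "S = (SUP z \<in> {..<n} \<rightarrow>\<^sub>E open_polydisc N. cmod (U z))"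
  define K where "K = exp (15/56 * harm (n - 1) :: real)"
  have K: "K > 0" by (simp add: K_def)
  have S: "cmod (U z) \<le> S" if "z \<in> {..<n} \<rightarrow>\<^sub>E closed_polydisc N" for z
    unfolding S_def by (rule multilinear_on_le_SUP[OF _ U that]) simp
  have "(\<lambda>k\<in>{..<n}. 0\<^sub>v N) \<in> {..<n} \<rightarrow>\<^sub>E closed_polydisc N" by (auto simp: closed_polydisc_def)
  from S[OF this] have S0: "S \<ge> 0" using norm_ge_zero order_trans by blast
  define q where "q = 2 * real n / (real n + 1)"
  define F where "F = (\<Sum>i \<in> {..<n} \<rightarrow>\<^sub>E {..<N}. cmod (U (basis_tuple {..<n} N i)) powr q)"
  have q: "q > 0" "(real n + 1) / (2 * real n) = 1 / q" using assms by (simp_all add: q_def)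
  have F0: "F \<ge> 0" unfolding F_def by (intro sum_nonneg) auto
  \<comment> \<open>the bound has to be positive, whereas \<open>S\<close> may vanish\<close>
  have "F powr (1 / q) \<le> K * S"
  proof (rule field_le_epsilon)
    fix e :: real assume e: "e > 0"
    have pos: "S + e / K > 0" using S0 e K by (simp add: add_nonneg_pos)
    have le: "cmod (U z) \<le> S + e / K" if "z \<in> {..<n} \<rightarrow>\<^sub>E closed_polydisc N" for z
      using S[OF that] e K by (simp add: add_increasing2)
    have "F \<le> (K * (S + e / K)) powr q"
      using multilinear_BH[OF _ _ U pos le, of "n - 1"] assms
      by (simp add: F_def q_def K_def algebra_simps of_nat_diff)
    then have "F powr (1 / q) \<le> ((K * (S + e / K)) powr q) powr (1 / q)"
      using F0 q by (intro powr_mono2) auto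
    also have "\<dots> = K * (S + e / K)" using q pos K by (simp add: powr_powr)
    also have "\<dots> = K * S + e" using K by (simp add: distrib_left)
    finally show "F powr (1 / q) \<le> K * S + e" .
  qed
  then show "(\<Sum>i \<in> {..<n} \<rightarrow>\<^sub>E {..<N}.
            cmod (U (\<lambda>k\<in>{..<n}. unit_vec N (i k))) powr (2 * real n / (real n + 1)))
          powr ((real n + 1) / (2 * real n))
        \<le> exp (15/56 * harm (n - 1)) * (SUP z \<in> {..<n} \<rightarrow>\<^sub>E open_polydisc N. cmod (U z))"
    unfolding q(2) unfolding F_def q_def basis_tuple_def K_def S_def .
qed

text \<open>
  A least constant exists: the admissible constants are closed under infima, since each instance of the
  inequality is linear in the constant with a nonnegative coefficient.
\<close>

lemma BH_const_le:
  assumes "bohnenblust_hille n C" "C \<ge> 1"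
  shows "BH_const n \<le> C"
proof -
  define P where "P = {C. 1 \<le> C \<and> bohnenblust_hille n C}"
  have C: "C \<in> P" using assms by (simp add: P_def)
  have bdd: "bdd_below P" by (rule bdd_belowI[of _ 1]) (simp add: P_def)
  have ge1: "Inf P \<ge> 1" using C by (intro cInf_greatest) (auto simp: P_def)
  have "bohnenblust_hille n (Inf P)"
    unfolding bohnenblust_hille_def
  proof (intro allI impI)
    fix N :: nat and U assume NU: "N \<ge> 1" "multilinear_form n N U"
    define S where "S = (SUP z \<in> {..<n} \<rightarrow>\<^sub>E open_polydisc N. cmod (U z))"
    have z: "(\<lambda>k\<in>{..<n}. 0\<^sub>v N) \<in> {..<n} \<rightarrow>\<^sub>E closed_polydisc N" by (auto simp: closed_polydisc_def)
    have "cmod (U (\<lambda>k\<in>{..<n}. 0\<^sub>v N)) \<le> S"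
      unfolding S_def using multilinear_on_le_SUP[OF _ NU(2)[unfolded multilinear_form_iff] z] by simp
    then have S0: "S \<ge> 0" using norm_ge_zero order_trans by blast
    define F where "F = (\<Sum>i \<in> {..<n} \<rightarrow>\<^sub>E {..<N}.
            cmod (U (\<lambda>k\<in>{..<n}. unit_vec N (i k))) powr (2 * real n / (real n + 1)))
          powr ((real n + 1) / (2 * real n))"
    have F: "F \<le> C * S" if "C \<in> P" for C
      using that NU unfolding P_def bohnenblust_hille_def F_def S_def by blast
    have "F \<le> Inf P * S"
    proof (cases "S = 0")
      case True
      then show ?thesis using F[OF C] by simp
    next
      case False
      then have "S > 0" using S0 by simp
      then have "F / S \<le> Inf P" using C F by (intro cInf_greatest) (auto simp: field_simps)
      then show ?thesis using \<open>S > 0\<close> by (simp add: field_simps)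
    qed
    then show "(\<Sum>i \<in> {..<n} \<rightarrow>\<^sub>E {..<N}.
            cmod (U (\<lambda>k\<in>{..<n}. unit_vec N (i k))) powr (2 * real n / (real n + 1)))
          powr ((real n + 1) / (2 * real n))
        \<le> Inf P * (SUP z \<in> {..<n} \<rightarrow>\<^sub>E open_polydisc N. cmod (U z))"
      by (simp add: F_def S_def)
  qed
  then have "BH_const n = Inf P"
    unfolding BH_const_def using ge1 bdd by (intro Least_equality) (auto simp: P_def intro: cInf_lower)
  then show ?thesis using cInf_lower[OF C bdd] by simp
qed

section \<open>Comparison with the explicit constants\<close>

lemma exp_15_56_le: "exp (15/56 :: real) \<le> 1.327"
proof -
  have "exp (15/112 :: real) \<le> 1 + 15/112 + (15/112)\<^sup>2" by (rule exp_bound) auto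
  then have "exp (15/112 :: real) ^ 2 \<le> (1 + 15/112 + (15/112)\<^sup>2) ^ 2" by (intro power_mono) auto
  also have "\<dots> \<le> 1.327" by (simp add: power2_eq_square)
  finally show ?thesis by (simp flip: exp_of_nat_mult)
qed

text \<open>
  From \<open>harm m \<le> 1 + ln m\<close> the left-hand side is at most \<open>exp (15/56) m powr (15/56)\<close>; the number 1.327 is an
  upper bound of \<open>exp (15/56)\<close>.  After that only \<open>m = 1\<close> matters, because \<open>A\<close> is at least that large.
\<close>

lemma exp_harm_less:
  fixes A B e :: real
  assumes m: "m \<ge> 1" and A: "A \<ge> 1.327" "A + B > 1.327" and e: "e \<ge> 15/56"
  shows "exp (15/56 * harm m) < A * real m powr e + B"
proof -
  define c :: real where "c = 15/56"
  have p1: "real m powr c \<ge> 1" using m by (simp add: ge_one_powr_ge_zero c_def)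
  have "harm m - ln (real m) \<le> (1 :: real)"
    using euler_mascheroni_sequence_decreasing[of 1 m] m by (simp add: harm_def)
  then have "c * harm m \<le> c + c * ln (real m)" unfolding c_def by (simp add: field_simps)
  then have "exp (c * harm m) \<le> exp c * real m powr c"
    using m by (simp add: powr_def flip: exp_add)
  also have "\<dots> \<le> 1.327 * real m powr c"
    using exp_15_56_le by (intro mult_right_mono) (auto simp: c_def)
  also have "\<dots> < A * real m powr c + B"
    using mult_left_mono[OF p1, of "A - 1.327"] A by (simp add: algebra_simps)
  also have "A * real m powr c \<le> A * real m powr e"
    using A(1) e m by (intro mult_left_mono powr_mono) (auto simp: c_def)
  finally show ?thesis by (simp add: c_def)
qed

lemma exp_minus_bounds:
  fixes x :: real
  assumes "x \<ge> 0"
  shows "exp (- x) \<ge> 1 - x + x\<^sup>2 / 2 - x ^ 3 / 6" and "exp (- x) \<le> 1 - x + x\<^sup>2 / 2"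
proof -
  obtain t where "exp (- x) = (\<Sum>m<4. (- x) ^ m / fact m) + exp t / fact 4 * (- x) ^ 4"
    using Maclaurin_exp_le[of "- x" 4] by auto
  then have "exp (- x) = 1 - x + x\<^sup>2 / 2 - x ^ 3 / 6 + exp t / 24 * x ^ 4"
    by (simp add: eval_nat_numeral)
  moreover have "exp t / 24 * x ^ 4 \<ge> 0" by simp
  ultimately show "exp (- x) \<ge> 1 - x + x\<^sup>2 / 2 - x ^ 3 / 6" by linarith
next
  obtain t where "exp (- x) = (\<Sum>m<3. (- x) ^ m / fact m) + exp t / fact 3 * (- x) ^ 3"
    using Maclaurin_exp_le[of "- x" 3] by auto
  then have "exp (- x) = 1 - x + x\<^sup>2 / 2 - exp t / 6 * x ^ 3"
    by (simp add: eval_nat_numeral)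
  moreover have "exp t / 6 * x ^ 3 \<ge> 0" using assms by simp
  ultimately show "exp (- x) \<le> 1 - x + x\<^sup>2 / 2" by linarith
qed

text \<open>
  Put \<open>d = (1 - \<gamma>) / 2\<close>, \<open>E = exp d\<close> and \<open>q = (1 - 1 / E) / d\<close>.  Then the exponent is \<open>d / ln 2\<close>, the
  leading coefficient is \<open>4 q ln 2 / \<surd>\<pi>\<close>, and the value at 1 simplifies to
  \<open>1 + 2 / \<surd>\<pi> (E - 1) (1 + 2 / E - 2 q ln 2)\<close>.  Numerically these are 0.305, 1.41 and 1.36, so crude
  bounds of \<open>\<gamma>\<close>, \<open>ln 2\<close> and \<open>\<pi>\<close> suffice.
\<close>

lemma explicit_constants:
  fixes \<gamma> C\<^sub>0 A e :: real
  assumes \<gamma>: "\<gamma> = euler_mascheroni"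
    and C\<^sub>0: "C\<^sub>0 = ((2 * exp (1/2) - 2 * exp (1/2 * \<gamma>)) / sqrt pi) *
               ((- 4 * exp (1/2) * ln 2 + (1 - \<gamma>) * (exp (1/2) + 2 * exp (1/2 * \<gamma>))) /
                (exp (1/2 * \<gamma> + 1/2) * (1 - \<gamma>))) + 1"
    and A: "A = (4 / sqrt pi - 4 / (exp (1/2 - 1/2 * \<gamma>) * sqrt pi)) /
            (1 + log 2 (exp (1/2 - 1/2 * \<gamma>) / 2))"
    and e: "e = log 2 (exp (1/2 - 1/2 * \<gamma>))"
  shows "A \<ge> 1.327" "A + C\<^sub>0 > 1.327" "e \<ge> 15/56"
proof -
  define d where "d = (1 - \<gamma>) / 2"
  define E where "E = exp d"
  define g where "g = exp (1/2 * \<gamma>)"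
  define s where "s = sqrt pi"
  define l :: real where "l = ln 2"
  define q where "q = (1 - exp (- d)) / d"
  have d: "d > 9/44" "d < 7/33"
    using euler_mascheroni_gt_19_over_33 euler_mascheroni_less_13_over_22 by (auto simp: d_def \<gamma>)
  have E: "E > 0" "1 / E = exp (- d)" by (simp_all add: E_def exp_minus field_simps)
  have g: "g > 0" by (simp add: g_def)
  have s: "s > 0" "s \<le> 1.7725"
  proof -
    show "s > 0" by (simp add: s_def)
    have "s\<^sup>2 \<le> 1.7725\<^sup>2" using pi_approx(2) by (simp add: s_def power2_eq_square)
    then show "s \<le> 1.7725" by (rule power2_le_imp_le) simp
  qed
  have l: "2/3 \<le> l" "l \<le> 25/36" "l > 0"
    using ln2_ge_two_thirds ln2_le_25_over_36 by (auto simp: l_def)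
  have ex: "exp (1/2 - 1/2 * \<gamma>) = E" "exp (1/2) = E * g" "exp (1/2 * \<gamma> + 1/2) = E * g\<^sup>2" "1 - \<gamma> = 2 * d"
    by (simp_all add: E_def g_def d_def power2_eq_square field_simps flip: exp_add)
  have logE: "log 2 E = d / l" by (simp add: log_def E_def l_def)
  have log2: "1 + log 2 (E / 2) = d / l"
    using E(1) logE by (simp add: log_divide)
  have inv_s: "1 / s \<ge> 0.5641" using s by (simp add: field_simps)
  have "q \<ge> 1 - d / 2"
  proof -
    have "(1 - d / 2) * d \<le> 1 - exp (- d)"
      using exp_minus_bounds(2)[of d] d by (simp add: power2_eq_square algebra_simps)
    then show ?thesis using d by (simp add: q_def pos_le_divide_eq)
  qed
  then have q1: "q \<ge> 59/66" using d by simp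
  have "q \<le> 1 - d / 2 + d\<^sup>2 / 6"
  proof -
    have "1 - exp (- d) \<le> (1 - d / 2 + d\<^sup>2 / 6) * d"
      using exp_minus_bounds(1)[of d] d by (simp add: power2_eq_square power3_eq_cube algebra_simps)
    then show ?thesis using d by (simp add: q_def pos_divide_le_eq)
  qed
  moreover have "d\<^sup>2 \<le> (7/33)\<^sup>2" using d by (intro power_mono) auto
  ultimately have q2: "q \<le> 0.9053" using d by (simp add: power2_eq_square)
  have Aq: "A = 4 * l * q * (1 / s)"
    unfolding A ex(1) log2 s_def[symmetric] q_def E(2)[symmetric] using d l s E by (simp add: field_simps)
  show "A \<ge> 1.327"
  proof -
    have "1.327 \<le> 4 * (2/3) * (59/66) * (0.5641 :: real)" by simp
    also have "\<dots> \<le> 4 * l * q * (1 / s)"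
      using l q1 inv_s by (intro mult_mono) auto
    finally show ?thesis by (simp only: Aq)
  qed
  show "e \<ge> 15/56"
    unfolding e ex(1) logE using d l by (simp add: pos_le_divide_eq)
  have sum: "A + C\<^sub>0 = 1 + 2 * (1 / s) * (E - 1) * (1 + 2 * exp (- d) - 2 * l * q)"
    unfolding A C\<^sub>0 ex log2 s_def[symmetric] l_def[symmetric] g_def[symmetric] q_def E(2)[symmetric]
    using d l s E g by (simp add: field_simps power2_eq_square)
  have "E - 1 \<ge> 0.2254"
  proof -
    have "(9/44)\<^sup>2 \<le> d\<^sup>2" using d by (intro power_mono) auto
    moreover have "1 + d + d\<^sup>2 / 2 \<le> E"
      unfolding E_def using d by (intro exp_lower_Taylor_quadratic) auto
    ultimately show ?thesis using d by (simp add: power2_eq_square)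
  qed
  moreover have "1 + 2 * exp (- d) - 2 * l * q \<ge> 1.355"
  proof -
    have "exp (- d) \<ge> exp (- (7/33))" using d by simp
    moreover have "exp (- (7/33)) \<ge> (0.808 :: real)"
    proof -
      have "(0.808 :: real) \<le> 1 - 7/33 + (7/33)\<^sup>2 / 2 - (7/33) ^ 3 / 6"
        by (simp add: power2_eq_square power3_eq_cube)
      also have "\<dots> \<le> exp (- (7/33))" by (rule exp_minus_bounds(1)) simp
      finally show ?thesis .
    qed
    ultimately have "exp (- d) \<ge> 0.808" by linarith
    moreover have "l * q \<le> 25/36 * 0.9053" using l q1 q2 by (intro mult_mono) auto
    ultimately show ?thesis by simp
  qed
  ultimately have "2 * 0.5641 * 0.2254 * 1.355 \<le> 2 * (1 / s) * (E - 1) * (1 + 2 * exp (- d) - 2 * l * q)"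
    using inv_s s(1) by (intro mult_mono mult_nonneg_nonneg) auto
  then show "A + C\<^sub>0 > 1.327" unfolding sum by simp
qed

theorem mainTheorem7:
  fixes \<gamma> C\<^sub>0 :: real
  assumes "\<gamma> = euler_mascheroni"
    and "C\<^sub>0 = ((2 * exp (1/2) - 2 * exp (1/2 * \<gamma>)) / sqrt pi) *
               ((- 4 * exp (1/2) * ln 2 + (1 - \<gamma>) * (exp (1/2) + 2 * exp (1/2 * \<gamma>))) /
                (exp (1/2 * \<gamma> + 1/2) * (1 - \<gamma>))) + 1"
  shows "(\<forall>n\<ge>2. BH_const n <
            (4 / sqrt pi - 4 / (exp (1/2 - 1/2 * \<gamma>) * sqrt pi)) /
            (1 + log 2 (exp (1/2 - 1/2 * \<gamma>) / 2)) *
            (real n - 1) powr log 2 (exp (1/2 - 1/2 * \<gamma>)) + C\<^sub>0) \<and>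
         (\<forall>n\<ge>2. BH_const n < 1.41 * (real n - 1) powr 0.304975 - 0.04)"
proof -
  have K: "BH_const n \<le> exp (15/56 * harm (n - 1))" if "n \<ge> 2" for n
  proof (rule BH_const_le)
    show "bohnenblust_hille n (exp (15/56 * harm (n - 1)))"
      using that by (intro bohnenblust_hille_exp_harm) simp
    show "exp (15/56 * harm (n - 1)) \<ge> (1 :: real)" by (simp add: harm_nonneg)
  qed
  have less: "BH_const n < A * (real n - 1) powr e + B"
    if "n \<ge> 2" "A \<ge> 1.327" "A + B > 1.327" "e \<ge> 15/56" for n and A B e :: real
  proof -
    have "exp (15/56 * harm (n - 1)) < A * real (n - 1) powr e + B"
      using that by (intro exp_harm_less) auto
    moreover have "real (n - 1) = real n - 1" using that(1) by (simp add: of_nat_diff)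
    ultimately show ?thesis using K[OF that(1)] by simp
  qed
  show ?thesis
  proof (intro conjI allI impI)
    fix n :: nat
    assume n: "n \<ge> 2"
    show "BH_const n <
            (4 / sqrt pi - 4 / (exp (1/2 - 1/2 * \<gamma>) * sqrt pi)) /
            (1 + log 2 (exp (1/2 - 1/2 * \<gamma>) / 2)) *
            (real n - 1) powr log 2 (exp (1/2 - 1/2 * \<gamma>)) + C\<^sub>0"
      by (rule less[OF n explicit_constants[OF assms refl refl]])
    show "BH_const n < 1.41 * (real n - 1) powr 0.304975 - 0.04"
      using less[OF n, of "1.41" "- 0.04" "0.304975"] by simp
  qed
qed

end
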